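(* For every $n\ge0$, the number of overpartitions of $n$ of the form $(\pi_1,\ldots,\pi_s)$ with $\pi_i\ge\pi_{i+1}$, such that $\pi_i\ge\pi_{i+2}+1$ (whenever $i+2\le s$) with strict inequality if $\pi_i$ is non-overlined, and such that whenever $\pi_i\le\pi_{i+1}+1$ with strict inequality if $\pi_i$ is overlined, then $|\pi_i|+|\pi_{i+1}|\equiv 1+\overline{V}(\pi_i)\pmod 2$, equals the number of overpartitions of $n$ whose non-overlined parts are all $\equiv1$ or $4\pmod5$.
   Context: An overpartition of $n$ is a partition of $n$ in which the first occurrence of a part size may be overlined. Parts are totally ordered by $1<\bar1<2<\bar2<\cdots$; overpartitions are listed in weakly decreasing order in this order, and all inequalities between parts are in this order, where $x+1$ denotes the part of size $|x|+1$ overlined iff $x$ is. $|x|$ is the size of a part. $\overline{V}(N)$ is the number of overlined parts of the overpartition that are $\le N$ in this order. *)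

theory Defs
  imports Main
begin

datatype part = Part (psize: nat) (overlined: bool)

text \<open>Parts are compared by size first; for equal sizes the non-overlined part is the smaller
  one (on booleans, \<^term>\<open>False < True\<close>).\<close>

instantiation part :: linorder
begin

definition less_eq_part :: "part \<Rightarrow> part \<Rightarrow> bool" where
  "x \<le> y \<longleftrightarrow> psize x < psize y \<or> (psize x = psize y \<and> overlined x \<le> overlined y)"

definition less_part :: "part \<Rightarrow> part \<Rightarrow> bool" where
  "x < y \<longleftrightarrow> psize x < psize y \<or> (psize x = psize y \<and> overlined x < overlined y)"

instance
  by standard (auto simp: less_eq_part_def less_part_def part.expand)

end

definition part_succ :: "part \<Rightarrow> part" where
  "part_succ x = Part (psize x + 1) (overlined x)"

text \<open>An overpartition is the list of its parts in weakly decreasing order. Since an overlined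
  part is larger than the non-overlined part of the same size, the part that may be overlined is
  the first of its size in this list.\<close>

definition overpartitions :: "nat \<Rightarrow> part list set" where
  "overpartitions n = {p.
     sorted_wrt (\<ge>) p \<and>
     (\<forall>x\<in>set p. 0 < psize x) \<and>
     (\<forall>i j. i < j \<and> j < length p \<and> psize (p ! i) = psize (p ! j) \<longrightarrow> \<not> overlined (p ! j)) \<and>
     sum_list (map psize p) = n}"

definition overlined_count :: "part list \<Rightarrow> part \<Rightarrow> nat" where
  "overlined_count p N = length (filter (\<lambda>x. overlined x \<and> x \<le> N) p)"

text \<open>List positions start at \<open>0\<close>, so \<open>p ! i\<close> is the part written \<open>\<pi>\<^bsub>i+1\<^esub>\<close> in the usual
  notation \<open>(\<pi>\<^sub>1, \<dots>, \<pi>\<^sub>s)\<close>.\<close>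

definition gap_condition :: "part list \<Rightarrow> bool" where
  "gap_condition p \<longleftrightarrow> (\<forall>i. i + 2 < length p \<longrightarrow>
     p ! i \<ge> part_succ (p ! (i + 2)) \<and>
     (\<not> overlined (p ! i) \<longrightarrow> p ! i > part_succ (p ! (i + 2))))"

definition parity_condition :: "part list \<Rightarrow> bool" where
  "parity_condition p \<longleftrightarrow> (\<forall>i. i + 1 < length p \<longrightarrow>
     p ! i \<le> part_succ (p ! (i + 1)) \<and>
     (overlined (p ! i) \<longrightarrow> p ! i < part_succ (p ! (i + 1))) \<longrightarrow>
     (psize (p ! i) + psize (p ! (i + 1))) mod 2 = (1 + overlined_count p (p ! i)) mod 2)"

lemma finite_overpartitions: "finite (overpartitions n)"
proof (rule finite_subset)
  let ?A = "(\<lambda>(m, b). Part m b) ` ({..n} \<times> UNIV)"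
  show "finite {p. set p \<subseteq> ?A \<and> length p \<le> n}"
    by (rule finite_lists_length_le) simp
  have len: "length p \<le> sum_list (map psize p)" if "\<forall>x\<in>set p. 0 < psize x" for p
    using that by (induction p) (auto simp: Suc_le_eq intro: add_less_le_mono order_le_less_trans)
  show "overpartitions n \<subseteq> {p. set p \<subseteq> ?A \<and> length p \<le> n}"
  proof
    fix p assume p: "p \<in> overpartitions n"
    have "x \<in> ?A" if "x \<in> set p" for x
    proof -
      have "psize x \<le> n"
        using p that member_le_sum_list[of "psize x" "map psize p"]
        by (auto simp: overpartitions_def)
      then show ?thesis
        by (intro image_eqI[where x = "(psize x, overlined x)"]) auto
    qed
    with p len[of p] show "p \<in> {p. set p \<subseteq> ?A \<and> length p \<le> n}"
      by (auto simp: overpartitions_def)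
  qed
qed

end

theory Submission
  imports Defs "HOL-Computational_Algebra.Formal_Power_Series"
begin

text \<open>Let \<open>A\<^sub>N\<close> be the generating function of the overpartitions with all parts of size \<open>> N\<close>, no
  non-overlined part \<open>N + 1\<close>, and both conditions of the theorem, and let \<open>B\<^sub>N\<close> be the same with the
  parity condition shifted by one. Removing the smallest parts gives
  \<open>A\<^sub>N = (1 + q\<^bsup>N+2\<^esup>) A\<^bsub>N+1\<^esub> + q\<^bsup>N+1\<^esup> B\<^bsub>N+1\<^esub>\<close> and
  \<open>B\<^sub>N = B\<^bsub>N+1\<^esub> + q\<^bsup>N+2\<^esup> (1 + q\<^bsup>N+2\<^esup>) B\<^bsub>N+2\<^esub> + q\<^bsup>N+1\<^esup> (1 + q\<^bsup>N+2\<^esup>) A\<^bsub>N+1\<^esub>\<close>.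
  With \<open>D\<^sub>N = \<Sum>\<^sub>r q\<^bsup>r\<^sup>2+Nr\<^esup> / (q; q)\<^sub>r\<close>, which satisfies \<open>D\<^sub>N = D\<^bsub>N+1\<^esub> + q\<^bsup>N+1\<^esup> D\<^bsub>N+2\<^esub>\<close>, the
  unique solution tending to \<open>1\<close> is \<open>A\<^sub>N = (-q\<^bsup>N+2\<^esup>; q)\<^sub>\<infinity> D\<^sub>N\<close>, \<open>B\<^sub>N = (-q\<^bsup>N+1\<^esup>; q)\<^sub>\<infinity> D\<^bsub>N+1\<^esub>\<close>.
  Hence the left side is counted by \<open>(1 + q) A\<^sub>0 = (-q; q)\<^sub>\<infinity> D\<^sub>0\<close>, and the theorem reduces to the
  first Rogers--Ramanujan identity for \<open>D\<^sub>0\<close>. The latter follows by applying Bailey's lemma twice to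
  the unit Bailey pair and from the Jacobi triple product. Infinite sums and products are replaced
  by finite ones that agree up to a prescribed power of \<open>q\<close>.\<close>

unbundle fps_syntax

subsection \<open>Gaussian binomials and Bailey's lemma\<close>

text \<open>The symbol \<open>(Q; Q)_n\<close>. The base is a parameter because both
  \<open>fps_X\<close> and \<open>fps_X ^ 5\<close> occur.\<close>

definition qpoch :: "'a::field fps \<Rightarrow> nat \<Rightarrow> 'a fps" where
  "qpoch Q n = (\<Prod>k=1..n. 1 - Q ^ k)"

definition inv_qpoch :: "'a::field fps \<Rightarrow> nat \<Rightarrow> 'a fps" where
  "inv_qpoch Q n = inverse (qpoch Q n)"

text \<open>The q-Pascal recursion defines Gaussian binomials without division, for every
  \<open>Q\<close>. The quotient formula is \<open>qbinomial_conv\<close>.\<close>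

fun qbinomial :: "'a::field fps \<Rightarrow> nat \<Rightarrow> nat \<Rightarrow> 'a fps" where
  "qbinomial Q n 0 = 1"
| "qbinomial Q 0 (Suc k) = 0"
| "qbinomial Q (Suc n) (Suc k) = qbinomial Q n k + Q ^ Suc k * qbinomial Q n (Suc k)"

lemma qpoch_0 [simp]: "qpoch Q 0 = 1"
  by (simp add: qpoch_def)

lemma qpoch_Suc: "qpoch Q (Suc n) = qpoch Q n * (1 - Q ^ Suc n)"
  by (simp add: qpoch_def)

lemma qpoch_nth_0: "Q $ 0 = 0 \<Longrightarrow> qpoch Q n $ 0 = 1"
  by (induction n) (simp_all add: qpoch_Suc)

lemma inv_qpoch_0 [simp]: "inv_qpoch Q 0 = 1"
  by (simp add: inv_qpoch_def)

lemma qpoch_inv_qpoch: "Q $ 0 = 0 \<Longrightarrow> qpoch Q n * inv_qpoch Q n = 1"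
  by (simp add: inv_qpoch_def qpoch_nth_0 inverse_mult_eq_1')

lemma inv_qpoch_Suc:
  assumes "Q $ 0 = 0"
  shows "inv_qpoch Q n = (1 - Q ^ Suc n) * inv_qpoch Q (Suc n)"
proof -
  have "inv_qpoch Q n = inv_qpoch Q n * (qpoch Q (Suc n) * inv_qpoch Q (Suc n))"
    by (simp add: qpoch_inv_qpoch assms)
  also have "\<dots> = (qpoch Q n * inv_qpoch Q n) * ((1 - Q ^ Suc n) * inv_qpoch Q (Suc n))"
    by (simp only: qpoch_Suc mult_ac)
  finally show ?thesis by (simp add: qpoch_inv_qpoch assms)
qed

lemma qbinomial_eq_0: "n < k \<Longrightarrow> qbinomial Q n k = 0"
  by (induction Q n k rule: qbinomial.induct) auto

lemma qbinomial_self [simp]: "qbinomial Q n n = 1"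
  by (induction n) (simp_all add: qbinomial_eq_0)

text \<open>Multiplied by the Pochhammer symbols, the two terms of the q-Pascal recursion become
  \<open>qpoch Q n\<close> times \<open>1 - Q ^ Suc k\<close> and
  \<open>Q ^ Suc k * (1 - Q ^ Suc d)\<close>; these add up to the missing factor
  \<open>1 - Q ^ Suc n\<close>.\<close>

lemma qbinomial_mult_qpoch:
  "k \<le> n \<Longrightarrow> qbinomial Q n k * qpoch Q k * qpoch Q (n - k) = qpoch Q n"
proof (induction Q n k rule: qbinomial.induct)
  case (3 Q n k)
  show ?case
  proof (cases "k = n")
    case False
    then obtain d where d: "n = Suc (k + d)"
      using 3 by (metis Suc_le_mono le_neq_implies_less less_iff_Suc_add)
    have 1: "qbinomial Q n k * qpoch Q k * qpoch Q (Suc d) = qpoch Q n"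
      using 3 d by simp
    have 2: "qbinomial Q n (Suc k) * qpoch Q (Suc k) * qpoch Q d = qpoch Q n"
      using 3 d by simp
    have "qbinomial Q (Suc n) (Suc k) * qpoch Q (Suc k) * qpoch Q (Suc d)
       = (qbinomial Q n k * qpoch Q k * qpoch Q (Suc d)) * (1 - Q ^ Suc k)
       + Q ^ Suc k * (1 - Q ^ Suc d) * (qbinomial Q n (Suc k) * qpoch Q (Suc k) * qpoch Q d)"
      unfolding qbinomial.simps qpoch_Suc by (simp add: algebra_simps del: power_Suc)
    also have "\<dots> = qpoch Q n * (1 - Q ^ Suc k * Q ^ Suc d)"
      unfolding 1 2 by (simp add: algebra_simps del: power_Suc)
    also have "Q ^ Suc k * Q ^ Suc d = Q ^ Suc n"
      by (simp add: d power_add)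
    finally show ?thesis using d by (simp add: qpoch_Suc)
  qed simp
qed auto

lemma qbinomial_conv:
  assumes "Q $ 0 = 0" "k \<le> n"
  shows "qbinomial Q n k = qpoch Q n * inv_qpoch Q k * inv_qpoch Q (n - k)"
proof -
  have "qpoch Q n * inv_qpoch Q k * inv_qpoch Q (n - k) = qbinomial Q n k *
     (qpoch Q k * inv_qpoch Q k) * (qpoch Q (n - k) * inv_qpoch Q (n - k))"
    unfolding qbinomial_mult_qpoch[OF assms(2), of Q, symmetric] by (simp only: mult_ac)
  then show ?thesis by (simp add: qpoch_inv_qpoch assms)
qed

lemma choose2_Suc: "Suc k choose 2 = (k choose 2) + k"
  by (simp add: numeral_2_eq_2)

text \<open>The form homogeneous in \<open>a\<close> and \<open>b\<close> allows a power of q for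
  \<open>a\<close> where the usual form would need negative exponents. The induction splits off the
  factor \<open>k = 0\<close> and replaces \<open>b\<close> by \<open>b * Q\<close> in the
  others.\<close>

lemma qbinomial_theorem:
  "(\<Prod>k<n. a + b * Q ^ k) = (\<Sum>k\<le>n. qbinomial Q n k * Q ^ (k choose 2) * a ^ (n - k) * b ^ k)"
proof (induction n arbitrary: b)
  case (Suc n)
  let ?t = "\<lambda>k. qbinomial Q n k * Q ^ (k choose 2) * Q ^ k * a ^ (n - k) * b ^ k"
  have "(\<Prod>k<Suc n. a + b * Q ^ k) = (a + b) * (\<Prod>k<n. a + (b * Q) * Q ^ k)"
    by (subst prod.lessThan_Suc_shift) (simp add: mult_ac)
  also have "\<dots> = (a + b) * (\<Sum>k\<le>n. ?t k)"
    unfolding Suc by (simp only: power_mult_distrib mult_ac)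
  also have "\<dots> = (\<Sum>k\<le>n. ?t k * a) + (\<Sum>k\<le>n. ?t k * b)"
    by (simp add: distrib_right sum_distrib_left sum.distrib mult_ac)
  also have "(\<Sum>k\<le>n. ?t k * a) = (\<Sum>k\<le>Suc n. ?t k * a)"
    by (simp add: qbinomial_eq_0)
  also have "\<dots> = a ^ Suc n + (\<Sum>k\<le>n. ?t (Suc k) * a)"
    by (subst sum.atMost_Suc_shift) (simp add: binomial_eq_0)
  also have "a ^ Suc n + (\<Sum>k\<le>n. ?t (Suc k) * a) + (\<Sum>k\<le>n. ?t k * b)
      = a ^ Suc n + (\<Sum>k\<le>n. ?t (Suc k) * a + ?t k * b)"
    by (simp add: sum.distrib)
  also have "(\<Sum>k\<le>n. ?t (Suc k) * a + ?t k * b) = (\<Sum>k\<le>n. qbinomial Q (Suc n) (Suc k)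
      * Q ^ (Suc k choose 2) * a ^ (Suc n - Suc k) * b ^ Suc k)"
  proof (rule sum.cong, goal_cases)
    case (2 k)
    show ?case
    proof (cases "k = n")
      case False
      with 2 have "n - k = Suc (n - Suc k)" by auto
      then show ?thesis unfolding choose2_Suc qbinomial.simps power_add diff_Suc_Suc
        by (simp add: algebra_simps)
    qed (simp add: choose2_Suc qbinomial_eq_0 power_add mult_ac)
  qed simp
  also have "a ^ Suc n + \<dots> = (\<Sum>k\<le>Suc n. qbinomial Q (Suc n) k
      * Q ^ (k choose 2) * a ^ (Suc n - k) * b ^ k)"
    by (subst sum.atMost_Suc_shift) (simp add: binomial_eq_0)
  finally show ?case .
qed (simp add: binomial_eq_0)

text \<open>The limit of the q-Chu-Vandermonde sum as the upper entry of its second Gaussian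
  binomial grows. After q-Pascal, \<open>inv_qpoch_Suc\<close> merges the two pieces into the sum
  for \<open>n\<close> and \<open>Suc m\<close>; hence \<open>m\<close> is arbitrary in the
  induction.\<close>

lemma qvandermonde_limit:
  assumes Q: "Q $ 0 = 0"
  shows "(\<Sum>s\<le>n. Q ^ (s * (s + m)) * qbinomial Q n s * inv_qpoch Q (s + m)) = inv_qpoch Q (n + m)"
proof (induction n arbitrary: m)
  case (Suc n)
  let ?t = "\<lambda>n m s. Q ^ (s * (s + m)) * qbinomial Q n s * inv_qpoch Q (s + m)"
  let ?u = "\<lambda>s. Q ^ (s * (s + m) + s) * qbinomial Q n s * inv_qpoch Q (s + m)"
  let ?v = "\<lambda>s. Q ^ (Suc s * (Suc s + m)) * qbinomial Q n s * inv_qpoch Q (Suc s + m)"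
  have "(\<Sum>s\<le>Suc n. ?t (Suc n) m s) = ?t (Suc n) m 0 + (\<Sum>s\<le>n. ?t (Suc n) m (Suc s))"
    by (rule sum.atMost_Suc_shift)
  also have "(\<Sum>s\<le>n. ?t (Suc n) m (Suc s)) = (\<Sum>s\<le>n. ?u (Suc s)) + (\<Sum>s\<le>n. ?v s)"
    unfolding sum.distrib[symmetric]
    by (rule sum.cong) (simp_all add: algebra_simps power_add)
  also have "?t (Suc n) m 0 + ((\<Sum>s\<le>n. ?u (Suc s)) + (\<Sum>s\<le>n. ?v s))
      = (\<Sum>s\<le>Suc n. ?u s) + (\<Sum>s\<le>n. ?v s)"
    unfolding sum.atMost_Suc_shift[of ?u n] by simp
  also have "\<dots> = (\<Sum>s\<le>n. ?u s + ?v s)"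
    by (simp add: sum.distrib qbinomial_eq_0)
  also have "\<dots> = (\<Sum>s\<le>n. ?t n (Suc m) s)"
  proof (rule sum.cong, goal_cases)
    case (2 s)
    let ?P = "Q ^ (s * (s + m) + s) * qbinomial Q n s" and ?Y = "Q ^ Suc (s + m)"
    let ?I = "inv_qpoch Q (Suc (s + m))"
    have "?u s = ?P * ((1 - ?Y) * ?I)"
      by (subst inv_qpoch_Suc[OF Q]) simp
    moreover have "Q ^ (Suc s * (Suc s + m)) = Q ^ (s * (s + m) + s) * ?Y"
      unfolding power_add[symmetric] by (simp add: algebra_simps)
    then have "?v s = ?P * (?Y * ?I)"
      by (simp only: mult_ac add_Suc)
    moreover have "?P * ((1 - ?Y) * ?I) + ?P * (?Y * ?I) = ?P * ?I"
      by (simp only: distrib_left[symmetric] distrib_right[symmetric] diff_add_cancel mult_1_left)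
    moreover have "s * (s + m) + s = s * (s + Suc m)"
      by simp
    ultimately show ?case by (simp only: add_Suc_right)
  qed simp
  finally show ?case using Suc[of "Suc m"] by simp
qed simp

text \<open>The shift \<open>r = s + j\<close> leads to \<open>qvandermonde_limit\<close> with
  \<open>m = 2 * j\<close>, because \<open>inv_qpoch Q (d - s) * inv_qpoch Q s\<close> is
  \<open>inv_qpoch Q d\<close> times a Gaussian binomial.\<close>

lemma bailey_kernel:
  assumes Q: "Q $ 0 = 0" and "j \<le> n"
  shows "(\<Sum>r=j..n. Q ^ (r\<^sup>2) * inv_qpoch Q (n - r) * inv_qpoch Q (r - j) * inv_qpoch Q (r + j))
    = Q ^ (j\<^sup>2) * inv_qpoch Q (n - j) * inv_qpoch Q (n + j)"
proof -
  obtain d where d: "n = j + d" using assms(2) le_Suc_ex by blast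
  let ?S = "\<Sum>r=j..n. Q ^ (r\<^sup>2) * inv_qpoch Q (n - r) * inv_qpoch Q (r - j) * inv_qpoch Q (r + j)"
  have "?S = (\<Sum>r=0+j..d+j. Q ^ (r\<^sup>2) * inv_qpoch Q (n - r) * inv_qpoch Q (r - j) * inv_qpoch Q (r + j))"
    by (simp add: d add.commute)
  also have "\<dots> = (\<Sum>s\<le>d. Q ^ ((s + j)\<^sup>2) * inv_qpoch Q (d - s) * inv_qpoch Q s * inv_qpoch Q (s + 2 * j))"
    by (subst sum.shift_bounds_cl_nat_ivl) (simp add: d atLeast0AtMost mult_2 add.assoc)
  also have "\<dots> = (\<Sum>s\<le>d. Q ^ (j\<^sup>2) * inv_qpoch Q d * (Q ^ (s * (s + 2 * j)) * qbinomial Q d s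
      * inv_qpoch Q (s + 2 * j)))"
  proof (rule sum.cong, goal_cases)
    case (2 s)
    have "(s + j)\<^sup>2 = j\<^sup>2 + s * (s + 2 * j)"
      by (simp add: power2_eq_square algebra_simps)
    moreover have "inv_qpoch Q d * qbinomial Q d s
        = (qpoch Q d * inv_qpoch Q d) * (inv_qpoch Q (d - s) * inv_qpoch Q s)"
      using 2 by (simp add: qbinomial_conv Q mult_ac)
    then have "inv_qpoch Q (d - s) * inv_qpoch Q s = inv_qpoch Q d * qbinomial Q d s"
      by (simp add: qpoch_inv_qpoch[OF Q])
    ultimately show ?case by (simp only: power_add mult.assoc) (simp only: mult.left_commute)
  qed simp
  also have "\<dots> = Q ^ (j\<^sup>2) * inv_qpoch Q d * inv_qpoch Q (d + 2 * j)"
    by (simp only: sum_distrib_left[symmetric] qvandermonde_limit[OF Q])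
  moreover have "d = n - j" "d + 2 * j = n + j" using d by auto
  ultimately show ?thesis by (simp add: add.commute)
qed

text \<open>Bailey's lemma relative to a = 1, with both free parameters sent to infinity: exchange
  the summations and apply \<open>bailey_kernel\<close>. The right side has the shape of the
  hypothesis with \<open>Q ^ (j\<^sup>2) * \<alpha> j\<close> for \<open>\<alpha> j\<close>, so the
  lemma can be iterated.\<close>

lemma bailey_lemma:
  assumes Q: "Q $ 0 = 0"
    and \<beta>: "\<And>r. \<beta> r = (\<Sum>j\<le>r. \<alpha> j * inv_qpoch Q (r - j) * inv_qpoch Q (r + j))"
  shows "(\<Sum>r\<le>n. Q ^ (r\<^sup>2) * inv_qpoch Q (n - r) * \<beta> r)
    = (\<Sum>j\<le>n. (Q ^ (j\<^sup>2) * \<alpha> j) * inv_qpoch Q (n - j) * inv_qpoch Q (n + j))"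
proof -
  let ?f = "\<lambda>r j. \<alpha> j * (Q ^ (r\<^sup>2) * inv_qpoch Q (n - r) * inv_qpoch Q (r - j) * inv_qpoch Q (r + j))"
  have "(\<Sum>r\<le>n. Q ^ (r\<^sup>2) * inv_qpoch Q (n - r) * \<beta> r) = (\<Sum>r\<le>n. \<Sum>j\<le>r. ?f r j)"
    by (simp add: \<beta> sum_distrib_left mult_ac)
  also have "\<dots> = (\<Sum>j\<le>n. \<Sum>r=j..n. ?f r j)"
    by (simp add: sum.Sigma) (rule sum.reindex_bij_witness[where i = prod.swap and j = prod.swap]; auto)
  also have "\<dots> = (\<Sum>j\<le>n. \<alpha> j * (Q ^ (j\<^sup>2) * inv_qpoch Q (n - j) * inv_qpoch Q (n + j)))"
    by (rule sum.cong) (simp_all only: sum_distrib_left[symmetric] atMost_iff bailey_kernel[OF Q])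
  finally show ?thesis by (simp add: mult_ac)
qed

text \<open>The unit Bailey pair relative to \<open>a = 1\<close>; the terms of index \<open>j\<close> and \<open>-j\<close> of the
  bilateral sum are merged, which keeps all indices natural numbers.\<close>

definition unit_alpha :: "'a::field fps \<Rightarrow> nat \<Rightarrow> 'a fps" where
  "unit_alpha Q j = (if j = 0 then 1 else (-1) ^ j * (Q ^ (j choose 2) + Q ^ (Suc j choose 2)))"

text \<open>Each truncation of the sum has a closed form, which makes an induction on the cut-off
  possible. The factor \<open>1 - Q ^ n\<close> stands for a denominator.\<close>

lemma unit_bailey_partial_sum:
  assumes Q: "Q $ 0 = 0" and "m < n"
  shows "(1 - Q ^ n) * (\<Sum>j\<le>m. unit_alpha Q j * inv_qpoch Q (n - j) * inv_qpoch Q (n + j))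
    = (-1) ^ m * Q ^ (Suc m choose 2) * inv_qpoch Q (n - Suc m) * inv_qpoch Q (n + m)"
  using assms(2)
proof (induction m)
  case 0
  then obtain k where k: "n = Suc k" by (cases n) auto
  then show ?case
    by (simp add: unit_alpha_def k inv_qpoch_Suc[OF Q, of k] binomial_eq_0 del: power_Suc)
next
  case (Suc m)
  then obtain d where d: "n = Suc (Suc (m + d))"
    using less_iff_Suc_add by (metis add_Suc)
  let ?c = "(-1) ^ m * Q ^ (Suc m choose 2)"
  let ?W = "inv_qpoch Q (Suc d) * inv_qpoch Q (Suc (n + m))"
  have eqs: "n - Suc m = Suc d" "n - Suc (Suc m) = d" "n + Suc m = Suc (n + m)"
    using d by auto
  have c: "Q ^ (Suc (Suc m) choose 2) = Q ^ (Suc m choose 2) * Q ^ Suc m"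
    by (simp only: choose2_Suc power_add)
  have n: "Q ^ Suc (n + m) = Q ^ n * Q ^ Suc m" "Q ^ n = Q ^ Suc m * Q ^ Suc d"
    unfolding power_add[symmetric] by (simp_all add: d)
  have "(1 - Q ^ n) * (\<Sum>j\<le>Suc m. unit_alpha Q j * inv_qpoch Q (n - j) * inv_qpoch Q (n + j))
    = ?c * inv_qpoch Q (Suc d) * inv_qpoch Q (n + m) + (1 - Q ^ n) * unit_alpha Q (Suc m) * ?W"
    using Suc by (simp add: distrib_left eqs mult_ac)
  also have "?c * inv_qpoch Q (Suc d) * inv_qpoch Q (n + m)
    = ?c * (1 - Q ^ Suc (n + m)) * ?W"
    by (simp add: inv_qpoch_Suc[OF Q, of "n + m"] mult_ac)
  also have "unit_alpha Q (Suc m) = - ?c * (1 + Q ^ Suc m)"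
    by (simp add: unit_alpha_def c algebra_simps del: power_Suc) (simp add: algebra_simps)
  \<comment> \<open>With \<open>Y = Q ^ Suc m\<close>, the bracket
    \<open>(1 - Q ^ n * Y) - (1 - Q ^ n) * (1 + Y)\<close> equals \<open>Q ^ n - Y\<close>, and
    \<open>Y\<close> divides \<open>Q ^ n\<close>.\<close>
  also have "?c * (1 - Q ^ Suc (n + m)) * ?W + (1 - Q ^ n) * (- ?c * (1 + Q ^ Suc m)) * ?W
    = - ?c * Q ^ Suc m * (1 - Q ^ Suc d) * ?W"
    unfolding n by (simp only: algebra_simps) (simp add: algebra_simps)
  also have "\<dots> = (-1) ^ Suc m * Q ^ (Suc (Suc m) choose 2) * inv_qpoch Q d * inv_qpoch Q (Suc (n + m))"
    unfolding c inv_qpoch_Suc[OF Q, of d] by (simp add: mult_ac)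
  finally show ?case unfolding eqs by simp
qed

text \<open>For \<open>n > 0\<close> the partial sum up to \<open>n - 1\<close> cancels against the
  last term, because \<open>1 - Q ^ (2 * n)\<close> factors as
  \<open>(1 - Q ^ n) * (1 + Q ^ n)\<close>.\<close>

lemma unit_bailey_pair:
  assumes Q: "Q $ 0 = 0"
  shows "(\<Sum>j\<le>n. unit_alpha Q j * inv_qpoch Q (n - j) * inv_qpoch Q (n + j)) = (if n = 0 then 1 else 0)"
    (is "?S = _")
proof (cases n)
  case (Suc m)
  have "(1 - Q ^ n) * ?S = (-1) ^ m * Q ^ (Suc m choose 2) * inv_qpoch Q (n + m)
      + (1 - Q ^ n) * unit_alpha Q n * inv_qpoch Q (n + n)"
    using unit_bailey_partial_sum[OF Q, of m n] by (simp add: Suc distrib_left mult_ac del: power_Suc)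
  also have "inv_qpoch Q (n + m) = (1 - Q ^ n * Q ^ n) * inv_qpoch Q (n + n)"
    using inv_qpoch_Suc[OF Q, of "n + m"] by (simp only: power_add[symmetric]) (simp add: Suc)
  also have "unit_alpha Q n = - ((-1) ^ m * Q ^ (Suc m choose 2)) * (1 + Q ^ n)"
    unfolding unit_alpha_def Suc choose2_Suc[of "Suc m"] power_add by (simp add: algebra_simps)
  finally have "(1 - Q ^ n) * ?S = 0" by (simp add: algebra_simps)
  moreover have "(1 - Q ^ n) $ 0 = 1" using Q Suc by simp
  then have "1 - Q ^ n \<noteq> 0" by (metis fps_zero_nth zero_neq_one)
  ultimately show ?thesis using Suc by simp
qed (simp add: unit_alpha_def)

text \<open>The first application of Bailey's lemma turns the unit pair into the pair with
  \<open>\<beta> n = inv_qpoch Q n\<close>; the second produces the Rogers-Ramanujan summand on the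
  left.\<close>

lemma finite_rogers_ramanujan:
  assumes Q: "Q $ 0 = 0"
  shows "(\<Sum>r\<le>n. Q ^ (r\<^sup>2) * inv_qpoch Q r * inv_qpoch Q (n - r))
    = (\<Sum>j\<le>n. Q ^ (2 * j\<^sup>2) * unit_alpha Q j * inv_qpoch Q (n - j) * inv_qpoch Q (n + j))"
proof -
  have "inv_qpoch Q n = (\<Sum>j\<le>n. (Q ^ (j\<^sup>2) * unit_alpha Q j) * inv_qpoch Q (n - j) * inv_qpoch Q (n + j))" for n
  proof -
    have "(\<Sum>r\<le>n. Q ^ (r\<^sup>2) * inv_qpoch Q (n - r) * (if r = 0 then 1 else 0)) = inv_qpoch Q n"
      by (simp add: if_distrib[of "\<lambda>x. _ * x"] sum.delta' cong: if_cong)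
    then show ?thesis
      using bailey_lemma[OF Q unit_bailey_pair[OF Q, symmetric], of n] by simp
  qed
  from bailey_lemma[OF Q this, of n] show ?thesis
    by (simp add: mult_ac power_mult[symmetric] power_add[symmetric] mult_2)
qed

section \<open>A finite Jacobi triple product in base \<open>fps_X ^ 5\<close>\<close>

lemma sum_atMost_double_centered:
  fixes g :: "nat \<Rightarrow> 'a::comm_monoid_add"
  shows "(\<Sum>k\<le>2 * n. g k) = (\<Sum>j\<le>n. if j = 0 then g n else g (n + j) + g (n - j))"
proof -
  have "{..2 * n} = {..<n} \<union> {0 + n..n + n}" by auto
  then have "(\<Sum>k\<le>2 * n. g k) = (\<Sum>k<n. g k) + (\<Sum>k=0 + n..n + n. g k)"
    by (simp only:) (rule sum.union_disjoint; auto)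
  also have "(\<Sum>k=0 + n..n + n. g k) = (\<Sum>j\<le>n. g (n + j))"
    by (subst sum.shift_bounds_cl_nat_ivl) (simp add: atLeast0AtMost add.commute)
  also have "\<dots> = g n + (\<Sum>j<n. g (n + Suc j))"
    by (simp add: lessThan_Suc_atMost[symmetric] sum.lessThan_Suc_shift del: sum.lessThan_Suc)
  also have "(\<Sum>k<n. g k) = (\<Sum>j<n. g (n - Suc j))"
    by (rule sum.nat_diff_reindex[symmetric])
  finally show ?thesis
    by (simp add: lessThan_Suc_atMost[symmetric] sum.lessThan_Suc_shift sum.distrib ac_simps
        del: sum.lessThan_Suc)
qed

lemma prod_lessThan_add:
  fixes h :: "nat \<Rightarrow> 'a::comm_monoid_mult"
  shows "(\<Prod>k<n + m. h k) = (\<Prod>k<n. h k) * (\<Prod>k<m. h (n + k))"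
  by (induction m) (simp_all add: mult_ac)

lemma square_eq_choose2: "j * j = 2 * (j choose 2) + j"
  by (induction j) (auto simp: choose2_Suc binomial_eq_0)

lemma choose2_add: "(a + b) choose 2 = (a choose 2) + (b choose 2) + a * b"
  by (induction b) (auto simp: choose2_Suc binomial_eq_0)

lemma prod_uminus_power:
  "(\<Prod>k<n. - ((fps_X :: 'a::field fps) ^ (a * k + b))) = (-1) ^ n * fps_X ^ (a * (n choose 2) + b * n)"
  by (induction n) (simp_all add: choose2_Suc binomial_eq_0 power_add algebra_simps)

text \<open>The \<open>q\<close>-binomial theorem in base \<open>q\<^sup>5\<close> with \<open>a = q\<^bsup>5n\<^esup>\<close> and \<open>b = -q\<^sup>3\<close>: this is the
  usual choice \<open>z = -q\<^bsup>3-5n\<^esup>\<close>, cleared of negative powers of \<open>q\<close>.\<close>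

lemma finite_jacobi_triple_product_mod5:
  "(\<Prod>i<n. (1 - fps_X ^ (5 * i + 2)) * (1 - fps_X ^ (5 * i + 3)))
    = (\<Sum>j\<le>n. fps_X ^ (2 * j\<^sup>2) * unit_alpha fps_X j * qbinomial (fps_X ^ 5 :: 'a::field fps) (2 * n) (n + j))"
    (is "?P = ?S")
proof -
  let ?X = "fps_X :: 'a fps"
  have rearrange: "q * x * y * ((s * t) * z) = s * e * (u * (t * v) * q)"
    if "x * y * z = e * (u * v)" for q x y z s t e u v :: "'a fps"
  proof -
    have "q * x * y * ((s * t) * z) = q * (s * t) * (x * y * z)"
      by (simp only: mult_ac)
    then show ?thesis unfolding that by (simp only: mult_ac)
  qed
  let ?h = "\<lambda>k. ?X ^ (5 * n) + (- (?X ^ 3)) * (?X ^ 5) ^ k"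
  \<comment> \<open>\<open>?c\<close> gathers the monomials to be pulled out:
    \<open>- (?X ^ (5 * i + 3))\<close> from each of the first \<open>n\<close> factors and
    \<open>?X ^ (5 * n)\<close> from each of the last \<open>n\<close>.\<close>
  let ?c = "(-1) ^ n * ?X ^ (5 * (n choose 2) + 3 * n + 5 * n * n)"
  let ?g = "\<lambda>k. qbinomial (?X ^ 5) (2 * n) k * (?X ^ 5) ^ (k choose 2) * (?X ^ (5 * n)) ^ (2 * n - k)
    * (- (?X ^ 3)) ^ k"
  have "(\<Prod>k<2 * n. ?h k) = (\<Prod>k<n. ?h k) * (\<Prod>k<n. ?h (n + k))"
    by (simp only: mult_2 prod_lessThan_add)
  \<comment> \<open>In reversed order the first \<open>n\<close> factors leave
    \<open>1 - ?X ^ (5 * k + 2)\<close>; the last \<open>n\<close> factors will leave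
    \<open>1 - ?X ^ (5 * k + 3)\<close>.\<close>
  also have "(\<Prod>k<n. ?h k) = (\<Prod>k<n. ?h (n - Suc k))"
    by (rule prod.nat_diff_reindex[symmetric])
  also have "\<dots> = (\<Prod>k<n. - (?X ^ (5 * (n - Suc k) + 3)) * (1 - ?X ^ (5 * k + 2)))"
  proof (rule prod.cong, goal_cases)
    case (2 k)
    then have "5 * n = (5 * (n - Suc k) + 3) + (5 * k + 2)" by auto
    then have "?X ^ (5 * n) = ?X ^ (5 * (n - Suc k) + 3) * ?X ^ (5 * k + 2)"
      by (simp only: power_add[symmetric])
    moreover have "?X ^ 3 * (?X ^ 5) ^ (n - Suc k) = ?X ^ (5 * (n - Suc k) + 3)"
      by (simp only: power_mult[symmetric] power_add[symmetric] add.commute)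
    ultimately show ?case by (simp only: mult_minus_left) (simp only: algebra_simps mult_1_right, simp)
  qed simp
  also have "\<dots> = (\<Prod>k<n. - (?X ^ (5 * (n - Suc k) + 3))) * (\<Prod>k<n. 1 - ?X ^ (5 * k + 2))"
    by (rule prod.distrib)
  also have "(\<Prod>k<n. - (?X ^ (5 * (n - Suc k) + 3))) = (\<Prod>k<n. - (?X ^ (5 * k + 3)))"
    by (rule prod.nat_diff_reindex)
  also have "\<dots> = (-1) ^ n * ?X ^ (5 * (n choose 2) + 3 * n)"
    by (rule prod_uminus_power)
  also have "(\<Prod>k<n. ?h (n + k)) = (\<Prod>k<n. ?X ^ (5 * n) * (1 - ?X ^ (5 * k + 3)))"
    by (rule prod.cong) (simp_all only: power_mult[symmetric] power_add distrib_left mult_minus_left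
        mult_minus_right
        mult_1_left mult_1_right mult_ac diff_conv_add_uminus)
  also have "\<dots> = ?X ^ (5 * n * n) * (\<Prod>k<n. 1 - ?X ^ (5 * k + 3))"
    by (simp add: prod.distrib power_mult)
  finally have lhs: "(\<Prod>k<2 * n. ?h k) = ?c * ?P"
    by (simp only: prod.distrib power_add mult_ac)
  \<comment> \<open>Centred at \<open>k = n\<close>, the terms \<open>n + j\<close> and
    \<open>n - j\<close> have equal Gaussian binomials, and their exponents yield the second and the
    first summand of \<open>unit_alpha\<close>.\<close>
  have rhs: "(\<Sum>k\<le>2 * n. ?g k) = ?c * ?S"
    unfolding sum_atMost_double_centered sum_distrib_left
  proof (rule sum.cong, goal_cases)
    case (2 j)
    then obtain d where d: "n = j + d" using le_Suc_ex by auto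
    have sym: "qbinomial (?X ^ 5) (2 * n) (n - j) = qbinomial (?X ^ 5) (2 * n) (n + j)"
      using 2 by (simp add: qbinomial_conv mult_ac)
    have jj: "2 * (j choose 2) + j = j * j"
      by (rule square_eq_choose2[symmetric])
    have "5 * ((n + j) choose 2) + 5 * n * (2 * n - (n + j)) + 3 * (n + j)
        = (5 * (n choose 2) + 3 * n + 5 * n * n) + (2 * j\<^sup>2 + (Suc j choose 2))"
      using jj unfolding d choose2_add choose2_Suc power2_eq_square by (simp add: algebra_simps)
    then have "(?X ^ 5) ^ ((n + j) choose 2) * (?X ^ (5 * n)) ^ (2 * n - (n + j)) * (?X ^ 3) ^ (n + j)
        = ?X ^ (5 * (n choose 2) + 3 * n + 5 * n * n) * (?X ^ (2 * j\<^sup>2) * ?X ^ (Suc j choose 2))"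
      by (simp only: power_mult[symmetric] power_add[symmetric])
    then have plus: "?g (n + j) = ?c * (?X ^ (2 * j\<^sup>2) * ((-1) ^ j * ?X ^ (Suc j choose 2))
        * qbinomial (?X ^ 5) (2 * n) (n + j))"
      unfolding power_minus[of "?X ^ 3"] power_add[of "-1" n j] by (rule rearrange)
    have "5 * ((n - j) choose 2) + 5 * n * (2 * n - (n - j)) + 3 * (n - j)
        = (5 * (n choose 2) + 3 * n + 5 * n * n) + (2 * j\<^sup>2 + (j choose 2))"
      using jj unfolding d choose2_add choose2_Suc power2_eq_square by (simp add: algebra_simps)
    then have expo: "(?X ^ 5) ^ ((n - j) choose 2) * (?X ^ (5 * n)) ^ (2 * n - (n - j)) * (?X ^ 3) ^ (n - j)
        = ?X ^ (5 * (n choose 2) + 3 * n + 5 * n * n) * (?X ^ (2 * j\<^sup>2) * ?X ^ (j choose 2))"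
      by (simp only: power_mult[symmetric] power_add[symmetric])
    have sign: "(-1) ^ (n - j) = (-1 :: 'a fps) ^ n * (-1) ^ j"
      by (simp add: d power_add[symmetric] minus_one_power_iff)
    have minus: "?g (n - j) = ?c * (?X ^ (2 * j\<^sup>2) * ((-1) ^ j * ?X ^ (j choose 2))
        * qbinomial (?X ^ 5) (2 * n) (n + j))"
      unfolding power_minus[of "?X ^ 3"] sym sign by (rule rearrange[OF expo])
    show ?case
    proof (cases "j = 0")
      case True
      then have "unit_alpha ?X j = (-1) ^ j * ?X ^ (j choose 2)"
        by (simp add: unit_alpha_def binomial_eq_0)
      then show ?thesis
        using minus True by (simp only: if_True refl diff_zero)
    next
      case False
      then have "unit_alpha ?X j = (-1) ^ j * ?X ^ (j choose 2) + (-1) ^ j * ?X ^ (Suc j choose 2)"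
        by (simp add: unit_alpha_def distrib_left)
      then show ?thesis
        unfolding if_not_P[OF False] plus minus by (simp only: distrib_left distrib_right add.commute)
    qed
  qed simp
  have "?c \<noteq> 0" by simp
  moreover have "?c * ?P = ?c * ?S"
    by (rule trans[OF lhs[symmetric] trans[OF qbinomial_theorem rhs]])
  ultimately show ?thesis by (rule iffD1[OF mult_left_cancel])
qed

subsection \<open>The first Rogers--Ramanujan identity modulo powers of the variable\<close>

lemma fps_nth_0_prod: "(\<Prod>i\<in>A. f i) $ 0 = (\<Prod>i\<in>A. f i $ 0 :: 'a::comm_ring_1)"
  by (induction A rule: infinite_finite_induct) simp_all

text \<open>Congruence modulo \<open>fps_X ^ (m + 1)\<close>.\<close>

definition fps_eq_upto :: "nat \<Rightarrow> 'a::comm_ring_1 fps \<Rightarrow> 'a fps \<Rightarrow> bool" where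
  "fps_eq_upto m f g \<longleftrightarrow> (\<forall>i\<le>m. f $ i = g $ i)"

lemma fps_eq_upto_refl [simp]: "fps_eq_upto m f f"
  by (simp add: fps_eq_upto_def)

lemma fps_eq_upto_sym: "fps_eq_upto m f g \<Longrightarrow> fps_eq_upto m g f"
  by (simp add: fps_eq_upto_def)

lemma fps_eq_upto_trans [trans]:
  "fps_eq_upto m f g \<Longrightarrow> fps_eq_upto m g h \<Longrightarrow> fps_eq_upto m f h"
  by (simp add: fps_eq_upto_def)

lemma fps_eq_upto_add:
  "fps_eq_upto m f g \<Longrightarrow> fps_eq_upto m f' g' \<Longrightarrow> fps_eq_upto m (f + f') (g + g')"
  by (simp add: fps_eq_upto_def)

lemma fps_eq_upto_mult:
  "fps_eq_upto m f g \<Longrightarrow> fps_eq_upto m f' g' \<Longrightarrow> fps_eq_upto m (f * f') (g * g')"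
  by (auto simp: fps_eq_upto_def fps_mult_nth intro!: sum.cong)

lemma fps_eq_upto_sum:
  "(\<And>i. i \<in> A \<Longrightarrow> fps_eq_upto m (f i) (g i)) \<Longrightarrow> fps_eq_upto m (sum f A) (sum g A)"
  by (auto simp: fps_eq_upto_def fps_sum_nth)

lemma fps_eq_upto_X_power: "m < k \<Longrightarrow> fps_eq_upto m (fps_X ^ k) 0"
  by (auto simp: fps_eq_upto_def)

lemma fps_eq_upto_X_power_mult: "m < k \<Longrightarrow> fps_eq_upto m (fps_X ^ k * f) 0"
  using fps_eq_upto_mult[OF fps_eq_upto_X_power, of m k f f] by simp

lemma fps_eq_upto_one_minus_X_power: "m < k \<Longrightarrow> fps_eq_upto m (1 - fps_X ^ k) 1"
  by (auto simp: fps_eq_upto_def)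

text \<open>A nonzero constant term makes \<open>u\<close> a unit, and multiplying by its inverse
  preserves the congruence.\<close>

lemma fps_eq_upto_cancel:
  fixes f g u :: "'a::field fps"
  assumes "u $ 0 \<noteq> 0" "fps_eq_upto m (f * u) (g * u)"
  shows "fps_eq_upto m f g"
  using fps_eq_upto_mult[OF assms(2) fps_eq_upto_refl[of m "inverse u"]] assms(1)
  by (simp add: mult.assoc inverse_mult_eq_1')

lemma fps_eq_upto_sum_truncate:
  assumes "m \<le> n" "\<And>r. r \<le> m \<Longrightarrow> fps_eq_upto m (f r) (g r)"
    "\<And>r. m < r \<Longrightarrow> fps_eq_upto m (f r) 0"
  shows "fps_eq_upto m (\<Sum>r\<le>n. f r) (\<Sum>r\<le>m. g r)"
proof -
  have "(\<Sum>r\<le>m. g r) = (\<Sum>r\<le>n. if r \<le> m then g r else 0)"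
    using assms(1) by (intro sum.mono_neutral_cong_left) auto
  then show ?thesis using assms by (auto intro!: fps_eq_upto_sum)
qed

lemma fps_eq_upto_prod_truncate:
  assumes "m \<le> n" "\<And>i. m \<le> i \<Longrightarrow> fps_eq_upto m (f i) 1"
  shows "fps_eq_upto m (\<Prod>i<n. f i) (\<Prod>i<m. f i)"
  using assms(1)
proof (induction n rule: dec_induct)
  case (step n)
  then show ?case
    using fps_eq_upto_mult[OF step.IH assms(2)[of n]] by simp
qed simp

lemma fps_eq_upto_qpoch:
  assumes "m \<le> n" "0 < d"
  shows "fps_eq_upto m (qpoch (fps_X ^ d) n) (qpoch (fps_X ^ d) m)"
proof -
  have eq: "qpoch (fps_X ^ d) n = (\<Prod>i<n. 1 - fps_X ^ (d * Suc i))" for n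
    by (induction n) (simp_all only: qpoch_0 qpoch_Suc prod.lessThan_Suc power_mult lessThan_0 prod.empty)
  have "m < d * Suc i" if "m \<le> i" for i
    using that assms(2) by (cases d) auto
  then show ?thesis
    unfolding eq by (intro fps_eq_upto_prod_truncate[OF assms(1)] fps_eq_upto_one_minus_X_power)
qed

lemma fps_eq_upto_inv_qpoch:
  assumes "m \<le> n" "0 < d"
  shows "fps_eq_upto m (inv_qpoch (fps_X ^ d) n) (inv_qpoch (fps_X ^ d) m)"
proof (rule fps_eq_upto_cancel)
  let ?X = "fps_X ^ d :: 'a fps"
  have X: "?X $ 0 = 0" using assms by simp
  then show "qpoch ?X n $ 0 \<noteq> 0" by (simp add: qpoch_nth_0)
  have "fps_eq_upto m (inv_qpoch ?X m * qpoch ?X n) (inv_qpoch ?X m * qpoch ?X m)"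
    by (intro fps_eq_upto_mult fps_eq_upto_qpoch assms fps_eq_upto_refl)
  then show "fps_eq_upto m (inv_qpoch ?X n * qpoch ?X n) (inv_qpoch ?X m * qpoch ?X n)"
    using qpoch_inv_qpoch[OF X] by (simp add: mult.commute fps_eq_upto_sym)
qed

lemma qpoch_mult5:
  "qpoch fps_X (5 * m) = qpoch (fps_X ^ 5) m
    * (\<Prod>i<m. (1 - fps_X ^ (5 * i + 1)) * (1 - fps_X ^ (5 * i + 4)))
    * (\<Prod>i<m. (1 - fps_X ^ (5 * i + 2)) * (1 - fps_X ^ (5 * i + 3)))"
proof (induction m)
  case (Suc m)
  let ?X = "fps_X :: 'a fps"
  have 1: "qpoch ?X (5 * Suc m) = qpoch ?X (5 * m) * (1 - ?X ^ (5 * m + 1)) * (1 - ?X ^ (5 * m + 2))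
      * (1 - ?X ^ (5 * m + 3)) * (1 - ?X ^ (5 * m + 4)) * (1 - ?X ^ (5 * Suc m))"
    by (simp add: eval_nat_numeral qpoch_Suc del: power_Suc)
  have 2: "qpoch (?X ^ 5) (Suc m) = qpoch (?X ^ 5) m * (1 - ?X ^ (5 * Suc m))"
    by (simp only: qpoch_Suc power_mult)
  show ?case
    unfolding 1 2 Suc prod.lessThan_Suc by (simp only: mult_ac)
qed simp

text \<open>Both \<open>S * (q; q)_m\<close> and \<open>P * (q^5; q^5)_m\<close> are congruent to
  the same truncated theta series \<open>\<theta>\<close>, by Bailey's lemma and by the triple
  product. Splitting \<open>(q; q)_(5m)\<close> by residues modulo 5 then lets the common unit be
  cancelled.\<close>

lemma rogers_ramanujan_upto:
  fixes m :: nat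
  defines "S \<equiv> \<Sum>r\<le>m. fps_X ^ (r\<^sup>2) * inv_qpoch (fps_X :: 'a::field fps) r"
  shows "fps_eq_upto m (S * (\<Prod>i<m. (1 - fps_X ^ (5 * i + 1)) * (1 - fps_X ^ (5 * i + 4)))) 1"
proof -
  let ?X = "fps_X :: 'a fps"
  \<comment> \<open>Unmerged, this is the sum of \<open>(-1)^j q^(j(5j-1)/2)\<close> over all
    integers j from -m to m.\<close>
  define \<theta> where "\<theta> = (\<Sum>j\<le>m. ?X ^ (2 * j\<^sup>2) * unit_alpha ?X j)"
  define P where "P = (\<Prod>i<m. (1 - ?X ^ (5 * i + 2)) * (1 - ?X ^ (5 * i + 3)))"
  define P' where "P' = (\<Prod>i<m. (1 - ?X ^ (5 * i + 1)) * (1 - ?X ^ (5 * i + 4)))"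
  let ?q = "qpoch ?X m" and ?i = "inv_qpoch ?X m"
  let ?q5 = "qpoch (?X ^ 5) m" and ?i5 = "inv_qpoch (?X ^ 5) m"
  note inv1 = fps_eq_upto_inv_qpoch[where d = 1 and 'a = 'a, unfolded power_one_right, OF _ zero_less_one]
  note inv5 = fps_eq_upto_inv_qpoch[where d = 5 and 'a = 'a]
  have small: "fps_eq_upto m (?X ^ (2 * j\<^sup>2) * f) 0" if "m < j" for f j
    using that by (intro fps_eq_upto_X_power_mult) (auto simp: power2_eq_square intro: order_less_le_trans)
  \<comment> \<open>The finite identities are used at \<open>2 * m\<close>: for
    \<open>r \<le> m\<close> the index \<open>2 * m - r\<close> is still at least \<open>m\<close>,
    so its Pochhammer symbol is already stable up to degree \<open>m\<close>, while terms with
    \<open>r > m\<close> vanish to that order.\<close>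
  have "fps_eq_upto m (S * ?i) (\<Sum>r\<le>2 * m. ?X ^ (r\<^sup>2) * inv_qpoch ?X r * inv_qpoch ?X (2 * m - r))"
    unfolding S_def sum_distrib_right mult.assoc
  proof (rule fps_eq_upto_sym, rule fps_eq_upto_sum_truncate)
    show "fps_eq_upto m (?X ^ r\<^sup>2 * (inv_qpoch ?X r * inv_qpoch ?X (2 * m - r))) 0" if "m < r" for r
      using that by (intro fps_eq_upto_X_power_mult) (auto simp: power2_eq_square intro: order_less_le_trans)
  qed (auto intro!: fps_eq_upto_mult inv1)
  also have "(\<Sum>r\<le>2 * m. ?X ^ (r\<^sup>2) * inv_qpoch ?X r * inv_qpoch ?X (2 * m - r)) =
      (\<Sum>j\<le>2 * m. ?X ^ (2 * j\<^sup>2) * unit_alpha ?X j * inv_qpoch ?X (2 * m - j) * inv_qpoch ?X (2 * m + j))"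
    by (rule finite_rogers_ramanujan) simp
  also have "fps_eq_upto m \<dots> (\<Sum>j\<le>m. ?X ^ (2 * j\<^sup>2) * unit_alpha ?X j * ?i * ?i)"
    by (rule fps_eq_upto_sum_truncate)
      (auto simp only: mult.assoc intro!: small, auto intro!: fps_eq_upto_mult inv1)
  also have "\<dots> = \<theta> * ?i * ?i"
    by (simp only: \<theta>_def sum_distrib_right)
  finally have "fps_eq_upto m (S * ?i * (?q * ?q)) (\<theta> * ?i * ?i * (?q * ?q))"
    by (rule fps_eq_upto_mult) simp
  moreover have "S * ?i * (?q * ?q) = S * ?q * (?q * ?i)"
    "\<theta> * ?i * ?i * (?q * ?q) = \<theta> * (?q * ?i) * (?q * ?i)"
    by (simp_all only: mult_ac)
  ultimately have 1: "fps_eq_upto m (S * ?q) \<theta>"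
    by (simp add: qpoch_inv_qpoch)
  have "fps_eq_upto m P (\<Prod>i<2 * m. (1 - ?X ^ (5 * i + 2)) * (1 - ?X ^ (5 * i + 3)))"
    unfolding P_def
    by (rule fps_eq_upto_sym, rule fps_eq_upto_prod_truncate)
      (auto simp del: power_Suc power_add_numeral2 add_2_eq_Suc' intro!: fps_eq_upto_mult[OF fps_eq_upto_one_minus_X_power fps_eq_upto_one_minus_X_power, unfolded mult_1_left])
  also have "\<dots> = (\<Sum>j\<le>2 * m. ?X ^ (2 * j\<^sup>2) * unit_alpha ?X j
      * qbinomial (?X ^ 5) (2 * (2 * m)) (2 * m + j))"
    by (rule finite_jacobi_triple_product_mod5)
  also have "fps_eq_upto m \<dots> (\<Sum>j\<le>m. ?X ^ (2 * j\<^sup>2) * unit_alpha ?X j * ?i5)"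
  proof (rule fps_eq_upto_sum_truncate)
    fix j assume j: "j \<le> m"
    have "qbinomial (?X ^ 5) (2 * (2 * m)) (2 * m + j) = qpoch (?X ^ 5) (2 * (2 * m))
        * inv_qpoch (?X ^ 5) (2 * m + j) * inv_qpoch (?X ^ 5) (2 * m - j)"
      using j by (subst qbinomial_conv) auto
    also have "fps_eq_upto m \<dots> (?q5 * ?i5 * ?i5)"
      using j by (intro fps_eq_upto_mult fps_eq_upto_qpoch inv5) auto
    finally have "fps_eq_upto m (qbinomial (?X ^ 5) (2 * (2 * m)) (2 * m + j)) ?i5"
      by (simp add: qpoch_inv_qpoch)
    then show "fps_eq_upto m (?X ^ (2 * j\<^sup>2) * unit_alpha ?X j
      * qbinomial (?X ^ 5) (2 * (2 * m)) (2 * m + j)) (?X ^ (2 * j\<^sup>2) * unit_alpha ?X j * ?i5)"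
      by (intro fps_eq_upto_mult fps_eq_upto_refl)
  qed (auto simp only: mult.assoc intro!: small)
  also have "\<dots> = \<theta> * ?i5"
    by (simp only: \<theta>_def sum_distrib_right)
  finally have "fps_eq_upto m (P * ?q5) (\<theta> * ?i5 * ?q5)"
    by (rule fps_eq_upto_mult) simp
  also have "\<theta> * ?i5 * ?q5 = \<theta> * (?q5 * ?i5)"
    by (simp only: mult_ac)
  also have "\<dots> = \<theta>"
    by (simp add: qpoch_inv_qpoch)
  finally have 2: "fps_eq_upto m (P * ?q5) \<theta>" .
  \<comment> \<open>Up to degree \<open>m\<close>, \<open>qpoch ?X (5 * m)\<close> agrees with
    \<open>?q\<close>, which brings in \<open>\<theta>\<close> and then
    \<open>P * ?q5\<close>.\<close>
  have "S * P' * (P * ?q5) = S * qpoch ?X (5 * m)"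
    unfolding qpoch_mult5 P_def P'_def by (simp only: mult_ac)
  also have "fps_eq_upto m \<dots> (S * ?q)"
    using fps_eq_upto_qpoch[of m "5 * m" 1, where 'a = 'a] by (intro fps_eq_upto_mult) auto
  also note 1
  also note 2[THEN fps_eq_upto_sym]
  finally have "fps_eq_upto m (S * P' * (P * ?q5)) (1 * (P * ?q5))"
    by simp
  moreover have "(P * ?q5) $ 0 \<noteq> 0"
    by (simp add: P_def qpoch_nth_0 fps_nth_0_prod)
  ultimately show ?thesis
    unfolding P'_def by (rule fps_eq_upto_cancel[rotated])
qed

subsection \<open>The conditions in terms of multiplicities\<close>

text \<open>This merges weak decrease with the rule that a repeated size is not overlined, so a
  single \<open>sorted_wrt\<close> describes overpartitions.\<close>

definition can_precede :: "part \<Rightarrow> part \<Rightarrow> bool" where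
  "can_precede x y \<longleftrightarrow> psize y < psize x \<or> psize y = psize x \<and> \<not> overlined y"

definition weight :: "part list \<Rightarrow> nat" where
  "weight p = sum_list (map psize p)"

definition overparts :: "nat \<Rightarrow> part list set" where
  "overparts N = {p. sorted_wrt can_precede p \<and> (\<forall>x\<in>set p. N < psize x)}"

lemma overpartitions_eq: "overpartitions n = {p \<in> overparts 0. weight p = n}"
proof -
  have "sorted_wrt (\<ge>) p \<and>
      (\<forall>i j. i < j \<and> j < length p \<and> psize (p ! i) = psize (p ! j) \<longrightarrow> \<not> overlined (p ! j))
      \<longleftrightarrow> sorted_wrt can_precede p" for p :: "part list"
    unfolding sorted_wrt_iff_nth_less can_precede_def less_eq_part_def by (auto 0 3)
  then show ?thesis
    unfolding overpartitions_def overparts_def weight_def by blast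
qed

lemma weight_append [simp]: "weight (p @ q) = weight p + weight q"
  by (simp add: weight_def)

lemma weight_Cons [simp]: "weight (x # p) = psize x + weight p"
  by (simp add: weight_def)

lemma weight_Nil [simp]: "weight [] = 0"
  by (simp add: weight_def)

text \<open>If \<open>f\<^sub>t\<close> and \<open>g\<^sub>t\<close> count the parts \<open>t\<close> and \<open>t\<close> overlined, then both conditions only concern
  the windows \<open>{t + 1, t overlined, t}\<close>: the gap condition says that each of them contains at most two
  parts. Two parts in a window sum to \<open>2t + f\<^bsub>t+1\<^esub>\<close>, whose parity does not change if all parts are
  shifted. The flag \<open>e\<close> is the parity of \<open>1 + v\<close>, where \<open>v\<close> is the number of overlined parts already
  removed from below.\<close>

definition overlined_upto :: "part list \<Rightarrow> nat \<Rightarrow> nat" where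
  "overlined_upto p t = length (filter (\<lambda>x. overlined x \<and> psize x \<le> t) p)"

definition window :: "part list \<Rightarrow> nat \<Rightarrow> nat" where
  "window p t = count_list p (Part (Suc t) False) + count_list p (Part t True) + count_list p (Part t False)"

definition good_at :: "bool \<Rightarrow> part list \<Rightarrow> nat \<Rightarrow> bool" where
  "good_at e p t \<longleftrightarrow> window p t \<le> 2 \<and>
    (window p t = 2 \<longrightarrow> odd (count_list p (Part (Suc t) False) + overlined_upto p t) = e)"

definition good :: "bool \<Rightarrow> part list \<Rightarrow> bool" where
  "good e p \<longleftrightarrow> (\<forall>t. good_at e p t)"

section \<open>Equivalence of the gap and parity conditions with \<open>good\<close>\<close>

lemma nat_all_split: "(\<forall>i::nat. P i) \<longleftrightarrow> P 0 \<and> (\<forall>i. P (Suc i))"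
  by (metis nat.exhaust)

lemma gap_condition_Cons:
  "gap_condition (x # p) \<longleftrightarrow> gap_condition p \<and> (1 < length p \<longrightarrow>
     x \<ge> part_succ (p ! 1) \<and> (\<not> overlined x \<longrightarrow> x > part_succ (p ! 1)))"
  unfolding gap_condition_def by (subst nat_all_split) auto

lemma overlined_count_Cons_irrelevant:
  assumes "sorted_wrt can_precede (x # p)" "y \<in> set p"
  shows "overlined_count (x # p) y = overlined_count p y"
  using assms by (auto simp: overlined_count_def can_precede_def less_eq_part_def)

lemma overlined_count_hd:
  assumes "sorted_wrt can_precede (x # p)"
  shows "overlined_count (x # p) x = length (filter overlined (x # p))"
proof -
  have "y \<le> x" if "y \<in> set p" for y
    using assms that by (auto simp: can_precede_def less_eq_part_def)
  then have "filter (\<lambda>y. overlined y \<and> y \<le> x) p = filter overlined p"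
    by (intro filter_cong) auto
  then show ?thesis by (simp add: overlined_count_def)
qed

text \<open>A new head is the largest part: it leaves the counts at later parts unchanged, and its
  own count includes every overlined part.\<close>

lemma parity_condition_Cons:
  assumes "sorted_wrt can_precede (x # p)"
  shows "parity_condition (x # p) \<longleftrightarrow> parity_condition p \<and> (p \<noteq> [] \<longrightarrow>
     x \<le> part_succ (p ! 0) \<and> (overlined x \<longrightarrow> x < part_succ (p ! 0)) \<longrightarrow>
     (psize x + psize (p ! 0)) mod 2 = (1 + length (filter overlined (x # p))) mod 2)"
  unfolding parity_condition_def
  by (subst nat_all_split)
    (use assms in \<open>auto simp: overlined_count_hd overlined_count_Cons_irrelevant simp del: filter.simps\<close>)

lemma overlined_upto_max:
  assumes "\<And>y. y \<in> set p \<Longrightarrow> overlined y \<Longrightarrow> psize y \<le> t"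
  shows "overlined_upto p t = length (filter overlined p)"
proof -
  have "filter (\<lambda>x. overlined x \<and> psize x \<le> t) p = filter overlined p"
    using assms by (intro filter_cong) auto
  then show ?thesis by (simp add: overlined_upto_def)
qed

text \<open>Only window \<open>s\<close> gains a part, and in \<open>p\<close> that window holds
  nothing but copies of \<open>Part s False\<close>. Higher windows are empty, so the changed
  overline count does not affect them.\<close>

lemma good_Cons_overlined:
  assumes "sorted_wrt can_precede (Part s True # p)"
  shows "good e (Part s True # p) \<longleftrightarrow> good e p \<and> count_list p (Part s False) \<le> 1 \<and>
    (count_list p (Part s False) = 1 \<longrightarrow> even (length (filter overlined p)) = e)"
proof -
  let ?x = "Part s True"
  have sz: "psize y < s \<or> y = Part s False" if "y \<in> set p" for y
    using assms that by (cases y) (auto simp: can_precede_def)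
  have zero: "count_list p (Part t b) = 0" if "s < t \<or> t = s \<and> b" for t b
    using sz that by (intro count_notin) force
  have other: "good_at e (?x # p) t \<longleftrightarrow> good_at e p t" if "t \<noteq> s" for t
    using that zero[of t] zero[of "Suc t"] by (cases "t < s") (auto simp: good_at_def window_def overlined_upto_def)
  have "overlined_upto p s = length (filter overlined p)"
    using sz by (intro overlined_upto_max) force
  then have "good_at e (?x # p) s \<longleftrightarrow> count_list p (Part s False) \<le> 1 \<and>
      (count_list p (Part s False) = 1 \<longrightarrow> even (length (filter overlined p)) = e)"
    using zero[of "Suc s"] zero[of s True]
    by (auto simp: good_at_def window_def overlined_upto_def)
  moreover have "good_at e p s" if "count_list p (Part s False) \<le> 1"
    using that zero[of "Suc s"] zero[of s True] by (simp add: good_at_def window_def)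
  ultimately show ?thesis
    unfolding good_def using other by metis
qed

text \<open>The new part enters the windows \<open>u\<close> and \<open>Suc u\<close>. The latter
  then holds only copies of that part, and its condition follows from the one for
  \<open>u\<close>.\<close>

lemma good_Cons_plain:
  assumes "sorted_wrt can_precede (Part (Suc u) False # p)"
  shows "good e (Part (Suc u) False # p) \<longleftrightarrow> good e p \<and> window p u \<le> 1 \<and>
    (window p u = 1 \<longrightarrow> even (count_list p (Part (Suc u) False) + length (filter overlined p)) = e)"
proof -
  let ?s = "Suc u"
  let ?x = "Part ?s False"
  have sz: "psize y < ?s \<or> y = Part ?s False" if "y \<in> set p" for y
    using assms that by (cases y) (auto simp: can_precede_def)
  have zero: "count_list p (Part t b) = 0" if "?s < t \<or> t = ?s \<and> b" for t b
    using sz that by (intro count_notin) force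
  have other: "good_at e (?x # p) t \<longleftrightarrow> good_at e p t" if "t \<noteq> ?s" "t \<noteq> u" for t
    using that by (auto simp: good_at_def window_def overlined_upto_def)
  have ov: "overlined_upto p u = length (filter overlined p)" "overlined_upto p ?s = length (filter overlined p)"
    using sz by (force intro!: overlined_upto_max)+
  have xov: "overlined_upto (?x # p) t = overlined_upto p t" for t
    by (simp add: overlined_upto_def)
  have u: "good_at e (?x # p) u \<longleftrightarrow> window p u \<le> 1 \<and>
    (window p u = 1 \<longrightarrow> even (count_list p ?x + length (filter overlined p)) = e)"
    unfolding good_at_def xov ov by (auto simp: window_def)
  have s: "good_at e (?x # p) ?s" if "good_at e (?x # p) u"
    using that zero[of "Suc ?s"] zero[of ?s True]
    unfolding good_at_def xov ov window_def by auto
  moreover have "good_at e p ?s" "good_at e p u" if "window p u \<le> 1"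
    using that zero[of "Suc ?s"] zero[of ?s True] by (auto simp add: good_at_def window_def)
  ultimately show ?thesis
    unfolding good_def using other u by metis
qed

lemma good_Nil: "good e []"
  by (simp add: good_def good_at_def window_def)

lemma mod2_eq_iff: "(a::nat) mod 2 = b mod 2 \<longleftrightarrow> (even a \<longleftrightarrow> even b)"
  by presburger

text \<open>By sortedness, copies of \<open>Part s False\<close> stand at the front of
  \<open>p\<close>, so the first two entries decide whether there are none, one or more.\<close>

lemma hd_conditions_overlined:
  assumes sorted: "sorted_wrt can_precede (x # p)" and x: "x = Part s True"
  shows "(1 < length p \<longrightarrow> x \<ge> part_succ (p ! 1) \<and> (\<not> overlined x \<longrightarrow> x > part_succ (p ! 1))) \<and>
    (p \<noteq> [] \<longrightarrow> x \<le> part_succ (p ! 0) \<and> (overlined x \<longrightarrow> x < part_succ (p ! 0)) \<longrightarrow>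
     (psize x + psize (p ! 0)) mod 2 = (1 + length (filter overlined (x # p))) mod 2) \<longleftrightarrow>
    count_list p (Part s False) \<le> 1 \<and>
    (count_list p (Part s False) = 1 \<longrightarrow> even (length (filter overlined p)))"
proof -
  have sz: "psize y < s \<or> y = Part s False" if "y \<in> set p" for y
    using sorted that x by (cases y) (auto simp: can_precede_def)
  have zero: "count_list (y # q) (Part s False) = 0"
    if "psize y < s" "sorted_wrt can_precede (y # q)" for y q
    using that by (intro count_notin) (auto simp: can_precede_def)
  \<comment> \<open>The hypothesis of the parity condition and the gap requirement are
    complementary: a part is either close to \<open>x\<close> or far enough from it.\<close>
  have near: "x \<le> part_succ y \<and> (overlined x \<longrightarrow> x < part_succ y) \<longleftrightarrow> y = Part s False"
    "x \<ge> part_succ y \<and> (\<not> overlined x \<longrightarrow> x > part_succ y) \<longleftrightarrow> y \<noteq> Part s False"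
    if "y \<in> set p" for y
    using sz[OF that] by (auto simp: x part_succ_def less_eq_part_def less_part_def)
  have G: "(1 < length p \<longrightarrow> x \<ge> part_succ (p ! 1) \<and> (\<not> overlined x \<longrightarrow> x > part_succ (p ! 1)))
      \<longleftrightarrow> (1 < length p \<longrightarrow> p ! 1 \<noteq> Part s False)"
    by (intro imp_cong refl near(2) nth_mem)
  have P: "(p \<noteq> [] \<longrightarrow> x \<le> part_succ (p ! 0) \<and> (overlined x \<longrightarrow> x < part_succ (p ! 0)) \<longrightarrow> c)
      \<longleftrightarrow> (p \<noteq> [] \<longrightarrow> p ! 0 = Part s False \<longrightarrow> c)" for c
    by (intro imp_cong refl near(1) nth_mem) simp
  show ?thesis
  proof (cases p)
    case (Cons y r)
    note p = this
    have y: "y \<in> set p" by (simp add: p)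
    show ?thesis
    proof (cases "y = Part s False")
      case False
      then have "count_list p (Part s False) = 0"
        using zero[of y r] sz[OF y] sorted by (simp add: p)
      moreover have "p ! 1 \<noteq> Part s False" if "1 < length p"
        using \<open>count_list p (Part s False) = 0\<close> nth_mem[OF that] by (metis count_list_0_iff)
      ultimately show ?thesis
        unfolding G P using False by (simp add: p)
    next
      case True
      then have c: "count_list p (Part s False) = Suc (count_list r (Part s False))"
        by (simp add: p)
      have parity: "(psize x + psize (p ! 0)) mod 2 = (1 + length (filter overlined (x # p))) mod 2
          \<longleftrightarrow> even (length (filter overlined p))"
        unfolding mod2_eq_iff using True x by (simp add: p)
      show ?thesis
      proof (cases r)
        case Nil
        then show ?thesis unfolding G P c parity using True by (simp add: p)
      next
        case (Cons z q)
        have z: "z \<in> set p" by (simp add: p Cons)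
        have "z = Part s False \<longleftrightarrow> count_list r (Part s False) \<noteq> 0"
          using zero[of z q] sz[OF z] sorted by (auto simp: p Cons)
        then show ?thesis unfolding G P c parity using True by (cases "z = Part s False") (auto simp: p Cons)
      qed
    qed
  qed simp
qed

text \<open>Here the parts close to \<open>x\<close> are those of size at least \<open>u\<close>,
  which are exactly the members of window \<open>u\<close>. They form an initial segment of
  \<open>p\<close>, so the first two entries again suffice.\<close>

lemma hd_conditions_plain:
  assumes sorted: "sorted_wrt can_precede (x # p)" and x: "x = Part (Suc u) False"
  shows "(1 < length p \<longrightarrow> x \<ge> part_succ (p ! 1) \<and> (\<not> overlined x \<longrightarrow> x > part_succ (p ! 1))) \<and>
    (p \<noteq> [] \<longrightarrow> x \<le> part_succ (p ! 0) \<and> (overlined x \<longrightarrow> x < part_succ (p ! 0)) \<longrightarrow>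
     (psize x + psize (p ! 0)) mod 2 = (1 + length (filter overlined (x # p))) mod 2) \<longleftrightarrow>
    window p u \<le> 1 \<and>
    (window p u = 1 \<longrightarrow> even (count_list p (Part (Suc u) False) + length (filter overlined p)))"
proof -
  have sz: "psize y < Suc u \<or> y = Part (Suc u) False" if "y \<in> set p" for y
    using sorted that x by (cases y) (auto simp: can_precede_def)
  have zero: "window (y # q) u = 0"
    if "psize y < u" "sorted_wrt can_precede (y # q)" for y q
    using that unfolding window_def by (auto simp: can_precede_def count_list_0_iff)
  have near: "x \<le> part_succ y \<and> (overlined x \<longrightarrow> x < part_succ y) \<longleftrightarrow> u \<le> psize y"
    "x \<ge> part_succ y \<and> (\<not> overlined x \<longrightarrow> x > part_succ y) \<longleftrightarrow> \<not> u \<le> psize y"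
    if "y \<in> set p" for y
    using sz[OF that] by (auto simp: x part_succ_def less_eq_part_def less_part_def)
  have win: "window (y # q) u = of_bool (u \<le> psize y) + window q u" if "y \<in> set p" for y q
    using sz[OF that] by (cases y; cases "overlined y") (auto simp: window_def)
  have G: "(1 < length p \<longrightarrow> x \<ge> part_succ (p ! 1) \<and> (\<not> overlined x \<longrightarrow> x > part_succ (p ! 1)))
      \<longleftrightarrow> (1 < length p \<longrightarrow> \<not> u \<le> psize (p ! 1))"
    by (intro imp_cong refl near(2) nth_mem)
  have P: "(p \<noteq> [] \<longrightarrow> x \<le> part_succ (p ! 0) \<and> (overlined x \<longrightarrow> x < part_succ (p ! 0)) \<longrightarrow> c)
      \<longleftrightarrow> (p \<noteq> [] \<longrightarrow> u \<le> psize (p ! 0) \<longrightarrow> c)" for c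
    by (intro imp_cong refl near(1) nth_mem) simp
  show ?thesis
  proof (cases p)
    case Nil
    then show ?thesis by (simp add: window_def)
  next
    case (Cons y r)
    note p = this
    have y: "y \<in> set p" by (simp add: p)
    show ?thesis
    proof (cases "u \<le> psize y")
      case False
      then have w: "window p u = 0"
        using zero[of y r] sorted by (simp add: p)
      have "\<not> u \<le> psize (p ! 1)" if "1 < length p"
      proof -
        have "can_precede y (p ! 1)" using that sorted by (simp add: p)
        then show ?thesis using False by (auto simp: can_precede_def)
      qed
      then show ?thesis
        unfolding G P w using False by (simp add: p)
    next
      case True
      then have w: "window p u = Suc (window r u)"
        by (simp add: p win[OF y])
      \<comment> \<open>With \<open>y\<close> the only close part, the sum of sizes is odd if
        \<open>psize y = u\<close> and even if \<open>y\<close> is a copy of \<open>x\<close>; the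
        count of \<open>Part (Suc u) False\<close> in \<open>p\<close> records which case
        holds.\<close>
      have parity: "(psize x + psize (p ! 0)) mod 2 = (1 + length (filter overlined (x # p))) mod 2
          \<longleftrightarrow> even (count_list p (Part (Suc u) False) + length (filter overlined p))"
        if "window r u = 0"
      proof -
        have "count_list r (Part (Suc u) False) = 0" using that by (simp add: window_def)
        moreover have "psize y = u \<or> y = Part (Suc u) False" using sz[OF y] True by auto
        ultimately show ?thesis
        proof (elim disjE)
          assume r: "count_list r (Part (Suc u) False) = 0" and yu: "psize y = u"
          then have "y \<noteq> Part (Suc u) False" by (cases y) auto
          then show ?thesis
            unfolding mod2_eq_iff using r yu by (simp add: p x)
        next
          assume r: "count_list r (Part (Suc u) False) = 0" and "y = Part (Suc u) False"
          then show ?thesis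
            unfolding mod2_eq_iff by (simp add: p x)
        qed
      qed
      show ?thesis
      proof (cases r)
        case Nil
        then have "window r u = 0" by (simp add: window_def)
        then show ?thesis unfolding G P w parity[OF \<open>window r u = 0\<close>]
          using True by (simp add: p Nil)
      next
        case (Cons z q)
        have z: "z \<in> set p" by (simp add: p Cons)
        have zw: "u \<le> psize z \<longleftrightarrow> window r u \<noteq> 0"
        proof (cases "u \<le> psize z")
          case True
          then show ?thesis using win[OF z, of q] by (simp add: Cons)
        next
          case False
          then show ?thesis using zero[of z q] sorted by (simp add: p Cons)
        qed
        show ?thesis
        proof (cases "window r u = 0")
          case wr: True
          then show ?thesis unfolding G P w parity[OF wr] using True zw by (simp add: p Cons)
        next
          case False
          then show ?thesis unfolding G P w using zw by (simp add: p Cons)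
        qed
      qed
    qed
  qed
qed

text \<open>Induction from the largest part downwards, matching the head conditions in the two
  descriptions. The flag is \<open>True\<close> because \<open>1 + v\<close> is odd when nothing has
  been removed.\<close>

lemma gap_parity_iff_good:
  assumes "p \<in> overparts 0"
  shows "gap_condition p \<and> parity_condition p \<longleftrightarrow> good True p"
  using assms
proof (induction p)
  case Nil
  show ?case by (simp add: gap_condition_def parity_condition_def good_Nil)
next
  case (Cons x p)
  have sorted: "sorted_wrt can_precede (x # p)" and p: "p \<in> overparts 0" and pos: "0 < psize x"
    using Cons.prems by (auto simp: overparts_def)
  let ?G = "1 < length p \<longrightarrow> x \<ge> part_succ (p ! 1) \<and> (\<not> overlined x \<longrightarrow> x > part_succ (p ! 1))"
  let ?P = "p \<noteq> [] \<longrightarrow>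
     x \<le> part_succ (p ! 0) \<and> (overlined x \<longrightarrow> x < part_succ (p ! 0)) \<longrightarrow>
     (psize x + psize (p ! 0)) mod 2 = (1 + length (filter overlined (x # p))) mod 2"
  have "good True (x # p) \<longleftrightarrow> good True p \<and> (?G \<and> ?P)"
  proof (cases "overlined x")
    case True
    then obtain s where x: "x = Part s True" by (cases x) auto
    show ?thesis
      unfolding hd_conditions_overlined[OF sorted x]
      using good_Cons_overlined[of s p True] sorted x by simp
  next
    case False
    then obtain u where x: "x = Part (Suc u) False" using pos by (cases x; cases "psize x") auto
    show ?thesis
      unfolding hd_conditions_plain[OF sorted x]
      using good_Cons_plain[of u p True] sorted x by simp
  qed
  then have eq: "good True (x # p) \<longleftrightarrow> (gap_condition p \<and> parity_condition p) \<and> (?G \<and> ?P)"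
    unfolding Cons.IH[OF p] .
  have shuffle: "((a \<and> c) \<and> (b \<and> d)) = X" if "X = ((a \<and> b) \<and> (c \<and> d))" for a b c d X
    using that by blast
  show ?case
    unfolding gap_condition_Cons parity_condition_Cons[OF sorted] by (rule shuffle[OF eq])
qed

subsection \<open>Removing the smallest parts\<close>

text \<open>The block of all parts of size \<open>t\<close> in list order, which ends the list when
  \<open>t\<close> is the smallest size.\<close>

definition level :: "nat \<Rightarrow> bool \<Rightarrow> nat \<Rightarrow> part list" where
  "level t g f = (if g then [Part t True] else []) @ replicate f (Part t False)"

lemma overparts_decompose:
  assumes "p \<in> overparts N"
  shows "\<exists>p' g f. p = p' @ level (Suc N) g f \<and> p' \<in> overparts (Suc N)"
  using assms
proof (induction p rule: rev_induct)
  case Nil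
  show ?case
    by (rule exI[of _ "[]"], rule exI[of _ False], rule exI[of _ 0]) (simp add: level_def overparts_def)
next
  case (snoc y p)
  have p: "p \<in> overparts N" and y: "N < psize y" and prec: "\<And>x. x \<in> set p \<Longrightarrow> can_precede x y"
    using snoc.prems by (auto simp: overparts_def sorted_wrt_append)
  consider "Suc N < psize y" | "y = Part (Suc N) True" | "y = Part (Suc N) False"
    using y by (cases y) (metis (full_types) Suc_lessI part.sel(1))
  then show ?case
  proof cases
    case 1
    then have "p @ [y] \<in> overparts (Suc N)"
      using snoc.prems prec by (fastforce simp: overparts_def can_precede_def)
    then show ?thesis
      by (intro exI[of _ "p @ [y]"] exI[of _ False] exI[of _ 0]) (simp add: level_def)
  next
    case 2
    then have "p \<in> overparts (Suc N)"
      using p prec by (auto simp: overparts_def can_precede_def)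
    then show ?thesis
      using 2 by (intro exI[of _ p] exI[of _ True] exI[of _ 0]) (simp add: level_def)
  next
    case 3
    from snoc.IH[OF p] obtain p' g f
      where "p = p' @ level (Suc N) g f" "p' \<in> overparts (Suc N)" by blast
    then show ?thesis
      using 3 by (intro exI[of _ p'] exI[of _ g] exI[of _ "Suc f"])
        (simp add: level_def replicate_append_same)
  qed
qed

lemma overparts_append_level:
  assumes "p \<in> overparts (Suc N)"
  shows "p @ level (Suc N) g f \<in> overparts N"
proof -
  have "sorted_wrt can_precede (replicate f (Part (Suc N) False))"
    by (induction f) (auto simp: can_precede_def)
  then show ?thesis
    using assms by (auto simp: overparts_def level_def sorted_wrt_append can_precede_def)
qed

lemma count_list_overparts:
  assumes "p \<in> overparts N" "t \<le> N"
  shows "count_list p (Part t b) = 0"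
  using assms by (auto simp: overparts_def count_list_0_iff)

lemma count_list_replicate: "count_list (replicate n x) y = (if x = y then n else 0)"
  by (induction n) auto

lemma overlined_upto_overparts:
  assumes "p \<in> overparts N" "t \<le> N"
  shows "overlined_upto p t = 0"
  using assms by (auto simp: overparts_def overlined_upto_def filter_empty_conv)

text \<open>An overlined part \<open>Suc N\<close> raises every overline count above it by one,
  which flips the flag for \<open>p\<close>. The genuinely new condition is that of window
  \<open>Suc N\<close>; it implies the conditions of window \<open>N\<close> in the extended list
  and of window \<open>Suc N\<close> in \<open>p\<close>.\<close>

lemma good_append_level:
  assumes "p \<in> overparts (Suc N)"
  defines "f' \<equiv> count_list p (Part (Suc (Suc N)) False)"
  shows "good e (p @ level (Suc N) g f) \<longleftrightarrow> good (e \<noteq> g) p \<and> f' + of_bool g + f \<le> 2 \<and>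
    (f' + of_bool g + f = 2 \<longrightarrow> odd (f' + of_bool g) = e)"
proof -
  let ?q = "p @ level (Suc N) g f"
  have cnt: "count_list ?q (Part t b) = (if t = Suc N then if b then of_bool g else f
      else count_list p (Part t b))" for t b
    using count_list_overparts[OF assms(1)]
    by (auto simp: level_def count_list_append count_list_replicate)
  have ov: "overlined_upto ?q t = overlined_upto p t + (if Suc N \<le> t then of_bool g else 0)" for t
    by (auto simp: level_def overlined_upto_def)
  have p0: "count_list p (Part t b) = 0" "overlined_upto p t = 0" if "t \<le> Suc N" for t b
    using that count_list_overparts overlined_upto_overparts assms(1) by auto
  have big: "good_at e ?q t \<longleftrightarrow> good_at (e \<noteq> g) p t" if "Suc N < t" for t
    using that unfolding good_at_def window_def cnt ov by auto
  have small: "good_at e ?q t" "good_at (e \<noteq> g) p t" if "t < N" for t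
    using that p0[of t] p0[of "Suc t"] unfolding good_at_def window_def cnt ov by auto
  have N: "good_at (e \<noteq> g) p N" "good_at e ?q N \<longleftrightarrow> f \<le> 2 \<and> (f = 2 \<longrightarrow> \<not> e)"
    using p0[of N] p0[of "Suc N"] unfolding good_at_def window_def cnt ov by auto
  have SN: "good_at (e \<noteq> g) p (Suc N) \<longleftrightarrow> f' \<le> 2 \<and> (f' = 2 \<longrightarrow> e = g)"
    "good_at e ?q (Suc N) \<longleftrightarrow> f' + of_bool g + f \<le> 2 \<and>
    (f' + of_bool g + f = 2 \<longrightarrow> odd (f' + of_bool g) = e)"
    using p0[of "Suc N"] unfolding good_at_def window_def cnt ov f'_def by auto
  have split: "good e' r \<longleftrightarrow> (\<forall>t<N. good_at e' r t) \<and> good_at e' r N \<and> good_at e' r (Suc N)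
      \<and> (\<forall>t>Suc N. good_at e' r t)" for e' r
    unfolding good_def by (metis Suc_lessI linorder_neqE_nat)
  show ?thesis
    unfolding split[of e] split[of "e \<noteq> g"] using big small N SN by (cases g) auto
qed

text \<open>For \<open>a = 0\<close> these are the sets counted by \<open>A\<^sub>N\<close> (flag
  \<open>True\<close>) and \<open>B\<^sub>N\<close> (flag \<open>False\<close>).\<close>

definition good_overparts :: "nat \<Rightarrow> bool \<Rightarrow> nat \<Rightarrow> part list set" where
  "good_overparts a e N = {p \<in> overparts N. good e p \<and> count_list p (Part (Suc N) False) \<le> a}"

lemma count_list_append_level:
  assumes "p \<in> overparts (Suc N)"
  shows "count_list (p @ level (Suc N) g f) (Part (Suc N) False) = f"
  using count_list_overparts[OF assms, of "Suc N"]
  by (simp add: level_def count_list_append count_list_replicate)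

text \<open>Window \<open>N\<close> contains only copies of \<open>Part (Suc N) False\<close>, and
  two of them force the even parity, hence \<open>e = False\<close>.\<close>

lemma good_bound:
  assumes "p \<in> overparts N" "good e p"
  shows "count_list p (Part (Suc N) False) \<le> (if e then 1 else 2)"
proof -
  have "good_at e p N" using assms(2) by (simp add: good_def)
  then show ?thesis
    using count_list_overparts[OF assms(1), of N] overlined_upto_overparts[OF assms(1), of N]
    unfolding good_at_def window_def by (auto simp: le_Suc_eq)
qed

lemma good_overparts_decompose:
  "p \<in> good_overparts a e N \<longleftrightarrow> (\<exists>p' g f. p = p' @ level (Suc N) g f \<and> f \<le> a \<and>
    p' \<in> good_overparts 2 (e \<noteq> g) (Suc N) \<and>
    count_list p' (Part (Suc (Suc N)) False) + of_bool g + f \<le> 2 \<and>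
    (count_list p' (Part (Suc (Suc N)) False) + of_bool g + f = 2 \<longrightarrow>
      odd (count_list p' (Part (Suc (Suc N)) False) + of_bool g) = e))"
    (is "?L \<longleftrightarrow> ?R")
proof
  assume L: ?L
  then obtain p' g f where "p = p' @ level (Suc N) g f" "p' \<in> overparts (Suc N)"
    using overparts_decompose by (force simp: good_overparts_def)
  then show ?R
    using L good_append_level[of p' N e g f] count_list_append_level[of p' N g f]
    unfolding good_overparts_def mem_Collect_eq
    by (intro exI[of _ p'] exI[of _ g] exI[of _ f]) simp
next
  assume ?R
  then obtain p' g f where "p = p' @ level (Suc N) g f" "f \<le> a"
    "p' \<in> good_overparts 2 (e \<noteq> g) (Suc N)"
    "count_list p' (Part (Suc (Suc N)) False) + of_bool g + f \<le> 2"
    "count_list p' (Part (Suc (Suc N)) False) + of_bool g + f = 2 \<longrightarrow>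
      odd (count_list p' (Part (Suc (Suc N)) False) + of_bool g) = e" by blast
  then show ?L
    using good_append_level[of p' N e g f] count_list_append_level[of p' N g f]
      overparts_append_level[of p' N g f]
    by (auto simp: good_overparts_def)
qed

section \<open>Set-level recurrences for removing the smallest parts\<close>

lemma good_overparts_E:
  assumes "p \<in> good_overparts a e N"
  obtains p' g f where "p = p' @ level (Suc N) g f" "f \<le> a" "p' \<in> good_overparts 2 (e \<noteq> g) (Suc N)"
    "count_list p' (Part (Suc (Suc N)) False) + of_bool g + f \<le> 2"
    "count_list p' (Part (Suc (Suc N)) False) + of_bool g + f = 2 \<longrightarrow>
      odd (count_list p' (Part (Suc (Suc N)) False) + of_bool g) = e"
  using assms unfolding good_overparts_decompose[of p a e N] by (elim exE conjE) (rule that)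

lemma good_overparts_mono: "a \<le> b \<Longrightarrow> good_overparts a e N \<subseteq> good_overparts b e N"
  by (auto simp: good_overparts_def)

text \<open>Write \<open>f'\<close> for the count of plain \<open>N + 2\<close> and \<open>g\<close>
  for the presence of overlined \<open>N + 1\<close>. The total \<open>f' + g = 2\<close> is even
  and thus excluded, leaving \<open>f' \<le> 1\<close> without the overlined part and
  \<open>f' = 0\<close> with it.\<close>

lemma good_overparts_0_True:
  "good_overparts 0 True N = good_overparts 1 True (Suc N) \<union>
    (\<lambda>p. p @ [Part (Suc N) True]) ` good_overparts 0 False (Suc N)" (is "?L = ?R")
proof (intro set_eqI iffI)
  fix p assume "p \<in> ?L"
  then obtain p' g f where "p = p' @ level (Suc N) g f" "f \<le> 0"
    "p' \<in> good_overparts 2 (True \<noteq> g) (Suc N)"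
    and c: "count_list p' (Part (Suc (Suc N)) False) + of_bool g + f \<le> 2"
    "count_list p' (Part (Suc (Suc N)) False) + of_bool g + f = 2 \<longrightarrow>
      odd (count_list p' (Part (Suc (Suc N)) False) + of_bool g) = True"
    by (rule good_overparts_E) (rule that)
  then have p': "p = p' @ level (Suc N) g 0" "p' \<in> good_overparts 2 (\<not> g) (Suc N)" "f = 0" by auto
  have "count_list p' (Part (Suc (Suc N)) False) + of_bool g \<noteq> 2"
  proof
    assume two: "count_list p' (Part (Suc (Suc N)) False) + of_bool g = 2"
    then have "odd (count_list p' (Part (Suc (Suc N)) False) + of_bool g)"
      using c(2) p'(3) by (simp only: add_0_right refl)
    then show False unfolding two by simp
  qed
  with c(1) p'(3) have c: "count_list p' (Part (Suc (Suc N)) False) + of_bool g \<le> 2"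
    "count_list p' (Part (Suc (Suc N)) False) + of_bool g \<noteq> 2"
    by (simp_all only: add_0_right not_False_eq_True)
  show "p \<in> ?R"
    using p' c by (cases g) (auto simp: good_overparts_def level_def)
next
  fix p assume "p \<in> ?R"
  then consider "p \<in> good_overparts 1 True (Suc N)"
    | p' where "p = p' @ [Part (Suc N) True]" "p' \<in> good_overparts 0 False (Suc N)" by auto
  then show "p \<in> ?L"
  proof cases
    case 1
    then show ?thesis unfolding good_overparts_decompose[of p 0 True]
      by (intro exI[of _ p] exI[of _ False] exI[of _ 0]) (auto simp: level_def good_overparts_def)
  next
    case 2
    then show ?thesis unfolding good_overparts_decompose[of p 0 True]
      by (intro exI[of _ p'] exI[of _ True] exI[of _ 0]) (auto simp: level_def good_overparts_def)
  qed
qed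

text \<open>Without plain \<open>N + 1\<close>, window \<open>N + 1\<close> holds at most one part.
  Adding one plain \<open>N + 1\<close> is therefore always allowed: if the window fills up, the
  parity is the required odd one.\<close>

lemma good_overparts_1_True:
  "good_overparts 1 True N = good_overparts 0 True N \<union>
    (\<lambda>p. p @ [Part (Suc N) False]) ` good_overparts 0 True N" (is "?L = ?R")
proof (intro set_eqI iffI)
  fix p assume "p \<in> ?L"
  then obtain p' g f where p': "p = p' @ level (Suc N) g f" "p' \<in> good_overparts 2 (\<not> g) (Suc N)" "f \<le> 1"
    and c: "count_list p' (Part (Suc (Suc N)) False) + of_bool g + f \<le> 2"
    "count_list p' (Part (Suc (Suc N)) False) + of_bool g + f = 2
      \<longrightarrow> odd (count_list p' (Part (Suc (Suc N)) False) + of_bool g)"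
    unfolding good_overparts_decompose[of p 1 True] by auto
  have f: "f = 0 \<or> f = Suc 0" using p'(3) by auto
  have "p' @ level (Suc N) g 0 \<in> good_overparts 0 True N"
    unfolding good_overparts_decompose[of _ 0 True]
    using p' c f by (intro exI[of _ p'] exI[of _ g] exI[of _ 0]) auto
  moreover have "p = p' @ level (Suc N) g 0 \<or> p = (p' @ level (Suc N) g 0) @ [Part (Suc N) False]"
    using p' f by (auto simp: level_def)
  ultimately show "p \<in> ?R" by blast
next
  fix p assume "p \<in> ?R"
  then consider "p \<in> good_overparts 0 True N"
    | q where "p = q @ [Part (Suc N) False]" "q \<in> good_overparts 0 True N" by auto
  then show "p \<in> ?L"
  proof cases
    case 1
    then show ?thesis using good_overparts_mono[of 0 1] by auto
  next
    case 2
    from 2(2) obtain p' g f where "q = p' @ level (Suc N) g f" "f \<le> 0"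
      "p' \<in> good_overparts 2 (True \<noteq> g) (Suc N)"
      and c: "count_list p' (Part (Suc (Suc N)) False) + of_bool g + f \<le> 2"
      "count_list p' (Part (Suc (Suc N)) False) + of_bool g + f = 2 \<longrightarrow>
        odd (count_list p' (Part (Suc (Suc N)) False) + of_bool g) = True"
      by (rule good_overparts_E) (rule that)
    then have p': "q = p' @ level (Suc N) g 0" "p' \<in> good_overparts 2 (\<not> g) (Suc N)" "f = 0" by auto
    have "count_list p' (Part (Suc (Suc N)) False) + of_bool g \<noteq> 2"
    proof
      assume two: "count_list p' (Part (Suc (Suc N)) False) + of_bool g = 2"
      then have "odd (count_list p' (Part (Suc (Suc N)) False) + of_bool g)"
        using c(2) p'(3) by (simp only: add_0_right refl)
      then show False unfolding two by simp
    qed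
    with c(1) p'(3) have c: "count_list p' (Part (Suc (Suc N)) False) + of_bool g \<le> 2"
      "count_list p' (Part (Suc (Suc N)) False) + of_bool g \<noteq> 2"
      by (simp_all only: add_0_right not_False_eq_True)
    have "count_list p' (Part (Suc (Suc N)) False) + of_bool g \<le> Suc 0"
      using c by linarith
    moreover have "p = p' @ level (Suc N) g 1"
      using 2 p' by (simp add: level_def)
    ultimately show ?thesis unfolding good_overparts_decompose[of p 1 True]
      using p' by (intro exI[of _ p'] exI[of _ g] exI[of _ 1]) auto
  qed
qed

text \<open>A total of two in window \<open>N + 1\<close> is now permitted, so one more plain
  \<open>N + 2\<close> may occur in either case; an overlined \<open>N + 1\<close> switches the flag
  to \<open>True\<close>.\<close>

lemma good_overparts_0_False:
  "good_overparts 0 False N = good_overparts 2 False (Suc N) \<union>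
    (\<lambda>p. p @ [Part (Suc N) True]) ` good_overparts 1 True (Suc N)" (is "?L = ?R")
proof (intro set_eqI iffI)
  fix p assume "p \<in> ?L"
  then obtain p' g where p': "p = p' @ level (Suc N) g 0" "p' \<in> good_overparts 2 g (Suc N)"
    and c: "count_list p' (Part (Suc (Suc N)) False) + of_bool g \<le> 2"
    unfolding good_overparts_decompose[of p 0 False] by auto
  show "p \<in> ?R"
    using p' c by (cases g) (auto simp: good_overparts_def level_def)
next
  fix p assume "p \<in> ?R"
  then consider "p \<in> good_overparts 2 False (Suc N)"
    | p' where "p = p' @ [Part (Suc N) True]" "p' \<in> good_overparts 1 True (Suc N)" by auto
  then show "p \<in> ?L"
  proof cases
    case 1
    then show ?thesis unfolding good_overparts_decompose[of p 0 False]
      by (intro exI[of _ p] exI[of _ False] exI[of _ 0]) (auto simp: level_def good_overparts_def)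
  next
    case 2
    then show ?thesis unfolding good_overparts_decompose[of p 0 False]
      by (intro exI[of _ p'] exI[of _ True] exI[of _ 0]) (auto simp: level_def good_overparts_def le_Suc_eq)
  qed
qed

text \<open>One or two copies of plain \<open>N + 1\<close> force the rest of window
  \<open>N + 1\<close> to be empty: one further part would fill it with odd parity, or overfill
  it.\<close>

lemma good_overparts_2_False:
  "good_overparts 2 False N = good_overparts 0 False N \<union>
    ((\<lambda>p. p @ [Part (Suc N) False]) ` good_overparts 0 False (Suc N) \<union>
    (\<lambda>p. p @ [Part (Suc N) False, Part (Suc N) False]) ` good_overparts 0 False (Suc N))" (is "?L = ?R")
proof (intro set_eqI iffI)
  fix p assume "p \<in> ?L"
  then obtain p' g f where p': "p = p' @ level (Suc N) g f" "f \<le> 2"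
    "p' \<in> good_overparts 2 (False \<noteq> g) (Suc N)"
    and c: "count_list p' (Part (Suc (Suc N)) False) + of_bool g + f \<le> 2"
    "count_list p' (Part (Suc (Suc N)) False) + of_bool g + f = 2 \<longrightarrow>
      odd (count_list p' (Part (Suc (Suc N)) False) + of_bool g) = False"
    by (rule good_overparts_E) (rule that)
  consider "f = 0" | "f = 1" | "f = 2" using p'(2) by linarith
  then show "p \<in> ?R"
  proof cases
    case 1
    then have "p \<in> good_overparts 0 False N"
      unfolding good_overparts_decompose[of _ 0 False]
      using p' c by (intro exI[of _ p'] exI[of _ g] exI[of _ 0]) auto
    then show ?thesis by blast
  next
    case 2
    then have "count_list p' (Part (Suc (Suc N)) False) + of_bool g = 0"
      using c by (cases "count_list p' (Part (Suc (Suc N)) False) + of_bool g") auto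
    with 2 p' show ?thesis by (auto simp: level_def good_overparts_def)
  next
    case 3
    then have "count_list p' (Part (Suc (Suc N)) False) + of_bool g = 0"
      using c by auto
    with 3 p' show ?thesis by (auto simp: level_def good_overparts_def numeral_2_eq_2)
  qed
next
  fix p assume "p \<in> ?R"
  then consider "p \<in> good_overparts 0 False N"
    | p' where "p = p' @ [Part (Suc N) False]" "p' \<in> good_overparts 0 False (Suc N)"
    | p' where "p = p' @ [Part (Suc N) False, Part (Suc N) False]" "p' \<in> good_overparts 0 False (Suc N)"
    by auto
  then show "p \<in> ?L"
  proof cases
    case 1
    then show ?thesis using good_overparts_mono[of 0 2] by auto
  next
    case 2
    then show ?thesis unfolding good_overparts_decompose[of p 2 False]
      by (intro exI[of _ p'] exI[of _ False] exI[of _ 1]) (auto simp: level_def good_overparts_def)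
  next
    case 3
    then show ?thesis unfolding good_overparts_decompose[of p 2 False]
      by (intro exI[of _ p'] exI[of _ False] exI[of _ 2]) (auto simp: level_def good_overparts_def numeral_2_eq_2)
  qed
qed

subsection \<open>Generating functions\<close>

text \<open>Rational coefficients provide the field required by \<open>inv_qpoch\<close>, and
  \<open>of_nat\<close> into them is injective, so coefficients determine cardinalities.\<close>

definition gf :: "part list set \<Rightarrow> rat fps" where
  "gf L = Abs_fps (\<lambda>n. of_nat (card {p \<in> L. weight p = n}))"

lemma overparts_antimono: "M \<le> N \<Longrightarrow> overparts N \<subseteq> overparts M"
  by (auto simp: overparts_def)

lemma finite_weight:
  assumes "L \<subseteq> overparts N"
  shows "finite {p \<in> L. weight p = n}"
proof (rule finite_subset[OF _ finite_overpartitions[of n]])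
  show "{p \<in> L. weight p = n} \<subseteq> overpartitions n"
    using assms overparts_antimono[of 0 N] by (auto simp: overpartitions_eq)
qed

lemma gf_Un:
  assumes "L \<subseteq> overparts N" "M \<subseteq> overparts N" "L \<inter> M = {}"
  shows "gf (L \<union> M) = gf L + gf M"
proof (rule fps_ext)
  fix n
  have "{p \<in> L \<union> M. weight p = n} = {p \<in> L. weight p = n} \<union> {p \<in> M. weight p = n}" by auto
  moreover have "card \<dots> = card {p \<in> L. weight p = n} + card {p \<in> M. weight p = n}"
    using assms by (intro card_Un_disjoint finite_weight) auto
  ultimately show "gf (L \<union> M) $ n = (gf L + gf M) $ n" by (simp add: gf_def)
qed

lemma gf_append: "gf ((\<lambda>p. p @ b) ` L) = fps_X ^ weight b * gf L"
proof (rule fps_ext)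
  fix n
  show "gf ((\<lambda>p. p @ b) ` L) $ n = (fps_X ^ weight b * gf L) $ n"
  proof (cases "n < weight b")
    case True
    then have "{p \<in> (\<lambda>p. p @ b) ` L. weight p = n} = {}" by auto
    then show ?thesis using True unfolding gf_def by (simp only: fps_nth_Abs_fps fps_X_power_mult_nth) simp
  next
    case False
    then have "{p \<in> (\<lambda>p. p @ b) ` L. weight p = n} = (\<lambda>p. p @ b) ` {p \<in> L. weight p = n - weight b}"
      by auto
    moreover have "card \<dots> = card {p \<in> L. weight p = n - weight b}"
      by (rule card_image) (simp add: inj_on_def)
    ultimately show ?thesis using False by (simp add: gf_def fps_X_power_mult_nth)
  qed
qed

text \<open>A nonempty list with all sizes above \<open>N\<close> has weight above \<open>N\<close>.
  This supplies the boundary value 1 for the recurrences.\<close>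

lemma gf_nth_low:
  assumes "L \<subseteq> overparts N" "[] \<in> L" "i \<le> N"
  shows "gf L $ i = (1 :: rat fps) $ i"
proof -
  have "N < weight p" if "p \<in> overparts N" "p \<noteq> []" for p
    using that by (cases p) (auto simp: overparts_def)
  then have "{p \<in> L. weight p = i} = (if i = 0 then {[]} else {})"
    using assms by (auto simp: subset_iff) force+
  then show ?thesis by (simp add: gf_def)
qed

lemma good_overparts_subset: "good_overparts a e N \<subseteq> overparts N"
  by (auto simp: good_overparts_def)

lemma Nil_good_overparts: "[] \<in> good_overparts a e N"
  by (simp add: good_overparts_def overparts_def good_Nil)

lemma gf_good_0_True:
  "gf (good_overparts 0 True N) = gf (good_overparts 1 True (Suc N))
    + fps_X ^ Suc N * gf (good_overparts 0 False (Suc N))"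
proof -
  have "gf (good_overparts 0 True N) = gf (good_overparts 1 True (Suc N)) +
    gf ((\<lambda>p. p @ [Part (Suc N) True]) ` good_overparts 0 False (Suc N))"
    unfolding good_overparts_0_True[of N]
  proof (rule gf_Un[where N = N])
    show "good_overparts 1 True (Suc N) \<subseteq> overparts N"
      "(\<lambda>p. p @ [Part (Suc N) True]) ` good_overparts 0 False (Suc N) \<subseteq> overparts N"
      using good_overparts_0_True[of N] good_overparts_subset by blast+
  qed (auto simp: good_overparts_def overparts_def)
  then show ?thesis by (simp add: gf_append del: power_Suc)
qed

lemma gf_good_1_True:
  "gf (good_overparts 1 True N) = (1 + fps_X ^ Suc N) * gf (good_overparts 0 True N)"
proof -
  have "gf (good_overparts 1 True N) = gf (good_overparts 0 True N) +
    gf ((\<lambda>p. p @ [Part (Suc N) False]) ` good_overparts 0 True N)"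
    unfolding good_overparts_1_True[of N]
  proof (rule gf_Un[where N = N])
    show "good_overparts 0 True N \<subseteq> overparts N"
      "(\<lambda>p. p @ [Part (Suc N) False]) ` good_overparts 0 True N \<subseteq> overparts N"
      using good_overparts_1_True[of N] good_overparts_subset by blast+
  qed (auto simp: good_overparts_def count_list_append)
  then show ?thesis by (simp add: gf_append distrib_right del: power_Suc)
qed

lemma gf_good_0_False:
  "gf (good_overparts 0 False N) = gf (good_overparts 2 False (Suc N))
    + fps_X ^ Suc N * gf (good_overparts 1 True (Suc N))"
proof -
  have "gf (good_overparts 0 False N) = gf (good_overparts 2 False (Suc N)) +
    gf ((\<lambda>p. p @ [Part (Suc N) True]) ` good_overparts 1 True (Suc N))"
    unfolding good_overparts_0_False[of N]
  proof (rule gf_Un[where N = N])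
    show "good_overparts 2 False (Suc N) \<subseteq> overparts N"
      "(\<lambda>p. p @ [Part (Suc N) True]) ` good_overparts 1 True (Suc N) \<subseteq> overparts N"
      using good_overparts_0_False[of N] good_overparts_subset by blast+
  qed (auto simp: good_overparts_def overparts_def)
  then show ?thesis by (simp add: gf_append del: power_Suc)
qed

lemma gf_good_2_False:
  "gf (good_overparts 2 False N) = gf (good_overparts 0 False N)
    + (fps_X ^ Suc N + fps_X ^ Suc N * fps_X ^ Suc N) * gf (good_overparts 0 False (Suc N))"
proof -
  let ?A = "(\<lambda>p. p @ [Part (Suc N) False]) ` good_overparts 0 False (Suc N)"
  let ?B = "(\<lambda>p. p @ [Part (Suc N) False, Part (Suc N) False]) ` good_overparts 0 False (Suc N)"
  have sub: "?A \<subseteq> overparts N" "?B \<subseteq> overparts N"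
    using good_overparts_2_False[of N] good_overparts_subset by blast+
  have "gf (good_overparts 2 False N) = gf (good_overparts 0 False N) + gf (?A \<union> ?B)"
    unfolding good_overparts_2_False[of N]
    using sub by (intro gf_Un[where N = N]) (auto simp: good_overparts_def count_list_append)
  also have "gf (?A \<union> ?B) = gf ?A + gf ?B"
    using sub by (intro gf_Un[where N = N]) (auto simp: good_overparts_def overparts_def)
  finally show ?thesis
    by (simp add: gf_append distrib_right power_add[symmetric] del: power_Suc)
qed

section \<open>Overpartitions with plain parts congruent to 1 or 4 modulo 5\<close>

definition plain_mod5 :: "nat \<Rightarrow> part list set" where
  "plain_mod5 N = {p \<in> overparts N. \<forall>x\<in>set p. \<not> overlined x \<longrightarrow> psize x mod 5 = 1 \<or> psize x mod 5 = 4}"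

lemma plain_mod5_subset: "plain_mod5 N \<subseteq> overparts N"
  by (auto simp: plain_mod5_def)

text \<open>Only one plain copy of \<open>N + 1\<close> is removed at a time, which returns to
  \<open>plain_mod5 N\<close> itself. The geometric series thus becomes a linear equation for the
  generating function.\<close>

lemma plain_mod5_step:
  "plain_mod5 N = (plain_mod5 (Suc N) \<union> (\<lambda>p. p @ [Part (Suc N) True]) ` plain_mod5 (Suc N)) \<union>
    (if Suc N mod 5 = 1 \<or> Suc N mod 5 = 4 then (\<lambda>p. p @ [Part (Suc N) False]) ` plain_mod5 N else {})"
    (is "?L = ?R")
proof (intro set_eqI iffI)
  fix p assume p: "p \<in> ?L"
  then obtain p' g f where p': "p = p' @ level (Suc N) g f" "p' \<in> overparts (Suc N)"
    using overparts_decompose[of p N] by (auto simp: plain_mod5_def)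
  then have p'': "p' \<in> plain_mod5 (Suc N)" using p by (auto simp: plain_mod5_def)
  show "p \<in> ?R"
  proof (cases f)
    case 0
    then show ?thesis using p' p'' by (auto simp: level_def)
  next
    case (Suc f')
    have eq: "p = (p' @ level (Suc N) g f') @ [Part (Suc N) False]"
      using p'(1) Suc by (simp add: level_def replicate_append_same)
    moreover have "p' @ level (Suc N) g f' \<in> plain_mod5 N"
      using p eq overparts_append_level[OF p'(2)] by (auto simp: plain_mod5_def)
    moreover have "Suc N mod 5 = 1 \<or> Suc N mod 5 = 4"
      using p eq by (auto simp: plain_mod5_def)
    ultimately show ?thesis by auto
  qed
next
  fix p assume "p \<in> ?R"
  then consider "p \<in> plain_mod5 (Suc N)"
    | q where "p = q @ [Part (Suc N) True]" "q \<in> plain_mod5 (Suc N)"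
    | q where "p = q @ [Part (Suc N) False]" "q \<in> plain_mod5 N" "Suc N mod 5 = 1 \<or> Suc N mod 5 = 4"
    by (auto split: if_splits)
  then show "p \<in> ?L"
  proof cases
    case 3
    then show ?thesis
      by (auto simp: plain_mod5_def overparts_def sorted_wrt_append can_precede_def Suc_lessI)
  qed (auto simp: plain_mod5_def overparts_def sorted_wrt_append can_precede_def)
qed

lemma gf_plain_mod5:
  "(if Suc N mod 5 = 1 \<or> Suc N mod 5 = 4 then 1 - fps_X ^ Suc N else 1) * gf (plain_mod5 N)
    = (1 + fps_X ^ Suc N) * gf (plain_mod5 (Suc N))"
proof -
  let ?A = "(\<lambda>p. p @ [Part (Suc N) True]) ` plain_mod5 (Suc N)"
  let ?C = "(\<lambda>p. p @ [Part (Suc N) False]) ` plain_mod5 N"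
  let ?B = "if Suc N mod 5 = 1 \<or> Suc N mod 5 = 4 then ?C else {}"
  have step: "plain_mod5 N = (plain_mod5 (Suc N) \<union> ?A) \<union> ?B"
    by (rule plain_mod5_step)
  then have "(plain_mod5 (Suc N) \<union> ?A) \<union> ?B \<subseteq> overparts N"
    using plain_mod5_subset[of N] by (rule subst)
  then have sub: "plain_mod5 (Suc N) \<union> ?A \<subseteq> overparts N"
    "plain_mod5 (Suc N) \<subseteq> overparts N" "?A \<subseteq> overparts N" "?B \<subseteq> overparts N"
    by (simp_all only: Un_subset_iff)
  have "gf (plain_mod5 N) = gf ((plain_mod5 (Suc N) \<union> ?A) \<union> ?B)"
    by (rule arg_cong[OF step])
  also have "\<dots> = gf (plain_mod5 (Suc N) \<union> ?A) + gf ?B"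
    using sub by (intro gf_Un[where N = N]) (auto simp: plain_mod5_def overparts_def)
  also have "gf (plain_mod5 (Suc N) \<union> ?A) = gf (plain_mod5 (Suc N)) + gf ?A"
    using sub by (intro gf_Un[where N = N]) (auto simp: plain_mod5_def overparts_def)
  also have "gf ?A = fps_X ^ Suc N * gf (plain_mod5 (Suc N))"
    by (simp add: gf_append del: power_Suc)
  finally have eq: "gf (plain_mod5 N) = gf (plain_mod5 (Suc N))
      + fps_X ^ Suc N * gf (plain_mod5 (Suc N)) + gf ?B" .
  show ?thesis
  proof (cases "Suc N mod 5 = 1 \<or> Suc N mod 5 = 4")
    case True
    have "gf ?B = fps_X ^ Suc N * gf (plain_mod5 N)"
      unfolding if_P[OF True] by (simp add: gf_append del: power_Suc)
    then have "gf (plain_mod5 N) = gf (plain_mod5 (Suc N))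
      + fps_X ^ Suc N * gf (plain_mod5 (Suc N)) + fps_X ^ Suc N * gf (plain_mod5 N)"
      by (rule subst) (rule eq)
    then show ?thesis
      unfolding if_P[OF True] left_diff_distrib distrib_right mult_1_left diff_eq_eq .
  next
    case False
    have "gf ?B = 0"
      unfolding if_not_P[OF False] by (simp add: gf_def fps_eq_iff)
    then show ?thesis
      using eq unfolding if_not_P[OF False] by (simp only: distrib_right mult_1_left add_0_right)
  qed
qed

section \<open>Solving the recurrences modulo powers of the variable\<close>

definition distinct_product :: "nat \<Rightarrow> nat \<Rightarrow> rat fps" where
  "distinct_product m N = (\<Prod>k=Suc N..m. 1 + fps_X ^ k)"

definition rr_sum :: "nat \<Rightarrow> nat \<Rightarrow> rat fps" where
  "rr_sum m N = (\<Sum>r\<le>m. fps_X ^ (r\<^sup>2 + N * r) * inv_qpoch fps_X r)"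

lemma distinct_product_step:
  "fps_eq_upto m ((1 + fps_X ^ Suc N) * distinct_product m (Suc N)) (distinct_product m N)"
proof (cases "N < m")
  case True
  then have "distinct_product m N = (1 + fps_X ^ Suc N) * distinct_product m (Suc N)"
    unfolding distinct_product_def by (subst prod.atLeast_Suc_atMost) auto
  then show ?thesis by simp
next
  case False
  then have "fps_eq_upto m (1 + fps_X ^ Suc N) (1 + 0 :: rat fps)"
    by (intro fps_eq_upto_add fps_eq_upto_X_power fps_eq_upto_refl) simp
  then show ?thesis using False by (simp add: distinct_product_def)
qed

text \<open>The difference of consecutive sums carries the factor \<open>1 - ?X ^ r\<close>, which
  cancels the last factor of the denominator; shifting \<open>r\<close> gives the third sum, up to
  one term of degree above \<open>m\<close>.\<close>

lemma rr_sum_step: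
  "fps_eq_upto m (rr_sum m (Suc N) + fps_X ^ Suc N * rr_sum m (Suc (Suc N))) (rr_sum m N)"
proof -
  let ?X = "fps_X :: rat fps"
  let ?t = "\<lambda>r. ?X ^ (r\<^sup>2 + Suc (Suc N) * r) * inv_qpoch ?X r"
  let ?u = "\<lambda>r. ?X ^ (r\<^sup>2 + N * r) * ((1 - ?X ^ r) * inv_qpoch ?X r)"
  have "rr_sum m N = (\<Sum>r\<le>m. ?X ^ (r\<^sup>2 + Suc N * r) * inv_qpoch ?X r + ?u r)"
    unfolding rr_sum_def by (rule sum.cong) (simp_all add: power_add algebra_simps)
  also have "\<dots> = rr_sum m (Suc N) + (\<Sum>r\<le>m. ?u r)"
    by (simp add: sum.distrib rr_sum_def)
  also have "(\<Sum>r\<le>m. ?u r) = ?u 0 + (\<Sum>r<m. ?u (Suc r))"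
    by (rule sum.atMost_shift)
  also have "?u 0 = 0" by simp
  also have "(\<Sum>r<m. ?u (Suc r)) = (\<Sum>r<m. ?X ^ Suc N * ?t r)"
  proof (rule sum.cong, goal_cases)
    case (2 r)
    have "(Suc r)\<^sup>2 + N * Suc r = Suc N + (r\<^sup>2 + Suc (Suc N) * r)"
      by (simp add: power2_eq_square)
    moreover have "(1 - ?X ^ Suc r) * inv_qpoch ?X (Suc r) = inv_qpoch ?X r"
      by (rule inv_qpoch_Suc[symmetric]) simp
    ultimately show ?case by (simp only: power_add mult.assoc)
  qed simp
  finally have eq: "rr_sum m N = rr_sum m (Suc N) + ?X ^ Suc N * (\<Sum>r<m. ?t r)"
    by (simp only: sum_distrib_left add_0_left)
  have "fps_eq_upto m (?X ^ Suc N * rr_sum m (Suc (Suc N))) (?X ^ Suc N * (\<Sum>r<m. ?t r) + 0)"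
  proof -
    have "m < Suc N + (m\<^sup>2 + Suc (Suc N) * m)" by simp
    then have low: "fps_eq_upto m (?X ^ Suc N * ?t m) 0"
      unfolding mult.assoc[symmetric] power_add[symmetric] by (rule fps_eq_upto_X_power_mult)
    have last: "?X ^ Suc N * rr_sum m (Suc (Suc N)) = ?X ^ Suc N * (\<Sum>r<m. ?t r) + ?X ^ Suc N * ?t m"
      unfolding rr_sum_def lessThan_Suc_atMost[symmetric] sum.lessThan_Suc distrib_left ..
    show ?thesis unfolding last by (intro fps_eq_upto_add low fps_eq_upto_refl)
  qed
  then show ?thesis
    unfolding eq add_0_right by (intro fps_eq_upto_add fps_eq_upto_refl)
qed

lemma rr_sum_low:
  assumes "m \<le> N"
  shows "fps_eq_upto m (rr_sum m N) 1"
proof -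
  have eq: "rr_sum m N = 1 + (\<Sum>r<m. fps_X ^ ((Suc r)\<^sup>2 + N * Suc r) * inv_qpoch fps_X (Suc r))"
    unfolding rr_sum_def by (subst sum.atMost_shift) simp
  have "fps_eq_upto m (\<Sum>r<m. fps_X ^ ((Suc r)\<^sup>2 + N * Suc r) * inv_qpoch fps_X (Suc r) :: rat fps)
      (\<Sum>r<m. 0)"
    using assms by (intro fps_eq_upto_sum fps_eq_upto_X_power_mult) (auto simp: power2_eq_square)
  from fps_eq_upto_add[OF fps_eq_upto_refl[of m 1] this] show ?thesis
    unfolding eq by simp
qed

lemma gf_low:
  assumes "L \<subseteq> overparts N" "[] \<in> L" "m \<le> N"
  shows "fps_eq_upto m (gf L) 1"
  using gf_nth_low[OF assms(1,2)] assms(3) by (simp add: fps_eq_upto_def)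

text \<open>Descending induction on \<open>N\<close>: for \<open>N \<ge> m\<close> everything is
  congruent to 1, and below that both sides obey the same recurrences. The one for flag
  \<open>False\<close> reaches \<open>N + 2\<close>, hence the strong induction.\<close>

lemma gf_good_overparts:
  "fps_eq_upto m (gf (good_overparts 0 True N)) (distinct_product m (Suc N) * rr_sum m N) \<and>
   fps_eq_upto m (gf (good_overparts 0 False N)) (distinct_product m N * rr_sum m (Suc N))"
proof (induction "m - N" arbitrary: N rule: less_induct)
  case less
  let ?X = "fps_X :: rat fps"
  let ?A = "\<lambda>N. gf (good_overparts 0 True N)" and ?B = "\<lambda>N. gf (good_overparts 0 False N)"
  let ?P = "distinct_product m" and ?D = "rr_sum m"
  show ?case
  proof (cases "m \<le> N")
    case True
    have one: "fps_eq_upto m (gf (good_overparts a e N)) 1" for a e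
      using gf_low[OF good_overparts_subset Nil_good_overparts True] .
    have "?P N = 1" "?P (Suc N) = 1"
      using True by (simp_all add: distinct_product_def)
    moreover have "fps_eq_upto m (?D N) 1" "fps_eq_upto m (?D (Suc N)) 1"
      using True by (auto intro: rr_sum_low)
    ultimately show ?thesis
      by (auto intro: fps_eq_upto_trans[OF one fps_eq_upto_sym])
  next
    case False
    note IH1 = less[of "Suc N"] and IH2 = less[of "Suc (Suc N)"]
    have A1: "fps_eq_upto m (?A (Suc N)) (?P (Suc (Suc N)) * ?D (Suc N))"
      and B1: "fps_eq_upto m (?B (Suc N)) (?P (Suc N) * ?D (Suc (Suc N)))"
      using IH1 False by auto
    have B2: "fps_eq_upto m (?B (Suc (Suc N))) (?P (Suc (Suc N)) * ?D (Suc (Suc (Suc N))))"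
      using IH2 False by auto
    let ?y = "?X ^ Suc N" and ?z = "?X ^ Suc (Suc N)"
    have zP: "fps_eq_upto m ((1 + ?z) * ?P (Suc (Suc N)) * f) (?P (Suc N) * f)" for f
      by (intro fps_eq_upto_mult distinct_product_step fps_eq_upto_refl)
    have "?A N = (1 + ?z) * ?A (Suc N) + ?y * ?B (Suc N)"
      by (simp only: gf_good_0_True[of N] gf_good_1_True)
    also have "fps_eq_upto m \<dots> ((1 + ?z) * (?P (Suc (Suc N)) * ?D (Suc N))
        + ?y * (?P (Suc N) * ?D (Suc (Suc N))))"
      by (intro fps_eq_upto_add fps_eq_upto_mult A1 B1 fps_eq_upto_refl)
    also have "\<dots> = (1 + ?z) * ?P (Suc (Suc N)) * ?D (Suc N) + ?P (Suc N) * (?y * ?D (Suc (Suc N)))"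
      by (simp only: mult_ac)
    also have "fps_eq_upto m \<dots> (?P (Suc N) * ?D (Suc N) + ?P (Suc N) * (?y * ?D (Suc (Suc N))))"
      by (intro fps_eq_upto_add zP fps_eq_upto_refl)
    also have "\<dots> = ?P (Suc N) * (?D (Suc N) + ?y * ?D (Suc (Suc N)))"
      by (simp only: distrib_left)
    also have "fps_eq_upto m \<dots> (?P (Suc N) * ?D N)"
      by (intro fps_eq_upto_mult rr_sum_step fps_eq_upto_refl)
    finally have A: "fps_eq_upto m (?A N) (?P (Suc N) * ?D N)" .
    \<comment> \<open>The sets with bounds 2 and 1 at \<open>Suc N\<close> are eliminated, so that
      only \<open>?A\<close> and \<open>?B\<close> remain.\<close>
    have "?B N = ?B (Suc N) + (1 + ?z) * (?z * ?B (Suc (Suc N))) + (1 + ?z) * (?y * ?A (Suc N))"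
      unfolding gf_good_0_False[of N] gf_good_2_False[of "Suc N"] gf_good_1_True[of "Suc N"]
      by (simp add: algebra_simps del: power_Suc)
    also have "fps_eq_upto m \<dots> (?P (Suc N) * ?D (Suc (Suc N))
        + (1 + ?z) * (?z * (?P (Suc (Suc N)) * ?D (Suc (Suc (Suc N)))))
        + (1 + ?z) * (?y * (?P (Suc (Suc N)) * ?D (Suc N))))"
      by (intro fps_eq_upto_add fps_eq_upto_mult A1 B1 B2 fps_eq_upto_refl)
    also have "\<dots> = ?P (Suc N) * ?D (Suc (Suc N))
        + (1 + ?z) * ?P (Suc (Suc N)) * (?z * ?D (Suc (Suc (Suc N))))
        + (1 + ?z) * ?P (Suc (Suc N)) * (?y * ?D (Suc N))"
      by (simp only: mult_ac)
    also have "fps_eq_upto m \<dots> (?P (Suc N) * ?D (Suc (Suc N))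
        + ?P (Suc N) * (?z * ?D (Suc (Suc (Suc N)))) + ?P (Suc N) * (?y * ?D (Suc N)))"
      by (intro fps_eq_upto_add zP fps_eq_upto_refl)
    also have "\<dots> = ?P (Suc N) * (?D (Suc (Suc N)) + ?z * ?D (Suc (Suc (Suc N))))
        + ?P (Suc N) * (?y * ?D (Suc N))"
      by (simp only: distrib_left)
    also have "fps_eq_upto m \<dots> (?P (Suc N) * ?D (Suc N) + ?P (Suc N) * (?y * ?D (Suc N)))"
      by (intro fps_eq_upto_add fps_eq_upto_mult rr_sum_step fps_eq_upto_refl)
    also have "\<dots> = (1 + ?y) * ?P (Suc N) * ?D (Suc N)"
      by (simp only: distrib_right distrib_left mult_1_left mult_ac)
    also have "fps_eq_upto m \<dots> (?P N * ?D (Suc N))"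
      by (intro fps_eq_upto_mult distinct_product_step fps_eq_upto_refl)
    finally have "fps_eq_upto m (?B N) (?P N * ?D (Suc N))" .
    with A show ?thesis ..
  qed
qed

text \<open>The optional plain part 1 contributes the factor \<open>1 + q\<close>, which completes
  the product of \<open>1 + q^k\<close>.\<close>

lemma gf_gap_parity:
  "fps_eq_upto m (gf (good_overparts 1 True 0)) (distinct_product m 0 * rr_sum m 0)"
proof -
  have "gf (good_overparts 1 True 0) = (1 + fps_X ^ Suc 0) * gf (good_overparts 0 True 0)"
    by (rule gf_good_1_True)
  also have "fps_eq_upto m \<dots> ((1 + fps_X ^ Suc 0) * (distinct_product m (Suc 0) * rr_sum m 0))"
    using gf_good_overparts by (intro fps_eq_upto_mult) auto
  also have "\<dots> = (1 + fps_X ^ Suc 0) * distinct_product m (Suc 0) * rr_sum m 0"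
    by (simp only: mult.assoc)
  also have "fps_eq_upto m \<dots> (distinct_product m 0 * rr_sum m 0)"
    by (intro fps_eq_upto_mult distinct_product_step fps_eq_upto_refl)
  finally show ?thesis .
qed

lemma gf_plain_mod5_product:
  "(\<Prod>k<N. if Suc k mod 5 = 1 \<or> Suc k mod 5 = 4 then 1 - fps_X ^ Suc k else 1) * gf (plain_mod5 0)
    = (\<Prod>k<N. 1 + fps_X ^ Suc k) * gf (plain_mod5 N)"
proof (induction N)
  case (Suc N)
  let ?c = "if Suc N mod 5 = 1 \<or> Suc N mod 5 = 4 then 1 - fps_X ^ Suc N else 1 :: rat fps"
  have "(\<Prod>k<Suc N. if Suc k mod 5 = 1 \<or> Suc k mod 5 = 4 then 1 - fps_X ^ Suc k else 1) * gf (plain_mod5 0)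
    = ?c * ((\<Prod>k<N. 1 + fps_X ^ Suc k) * gf (plain_mod5 N))"
    unfolding Suc[symmetric] prod.lessThan_Suc by (simp only: mult_ac)
  also have "\<dots> = (\<Prod>k<N. 1 + fps_X ^ Suc k) * (?c * gf (plain_mod5 N))"
    by (rule mult.left_commute)
  also have "\<dots> = (\<Prod>k<Suc N. 1 + fps_X ^ Suc k) * gf (plain_mod5 (Suc N))"
    unfolding gf_plain_mod5 prod.lessThan_Suc by (simp only: mult_ac)
  finally show ?case .
qed simp

lemma prod_mod5_residues:
  "(\<Prod>k<5 * m. if Suc k mod 5 = 1 \<or> Suc k mod 5 = 4 then 1 - fps_X ^ Suc k else (1 :: 'a::comm_ring_1 fps))
    = (\<Prod>i<m. (1 - fps_X ^ (5 * i + 1)) * (1 - fps_X ^ (5 * i + 4)))"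
proof (induction m)
  case (Suc m)
  let ?f = "\<lambda>k. if Suc k mod 5 = 1 \<or> Suc k mod 5 = 4 then 1 - fps_X ^ Suc k else (1 :: 'a fps)"
  have "(\<Prod>k<5 * Suc m. ?f k) = (\<Prod>k<5 * m + 5. ?f k)"
    by (simp add: add.commute)
  also have "\<dots> = (\<Prod>k<5 * m. ?f k) * (\<Prod>k<5. ?f (5 * m + k))"
    by (rule prod_lessThan_add)
  also have "(\<Prod>k<5. ?f (5 * m + k)) = (1 - fps_X ^ (5 * m + 1)) * (1 - fps_X ^ (5 * m + 4))"
  proof -
    have five: "(\<Prod>k<5. g k) = g 0 * g 1 * g 2 * g 3 * g 4" for g :: "nat \<Rightarrow> 'a fps"
      by (simp add: eval_nat_numeral)
    have res: "Suc (5 * m + 0) mod 5 = 1" "Suc (5 * m + 1) mod 5 = 2" "Suc (5 * m + 2) mod 5 = 3"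
      "Suc (5 * m + 3) mod 5 = 4" "Suc (5 * m + 4) mod 5 = 0"
      by presburger+
    have suc: "Suc (5 * m + 0) = 5 * m + 1" "Suc (5 * m + 3) = 5 * m + 4"
      by simp_all
    show ?thesis
      unfolding five[of "\<lambda>k. ?f (5 * m + k)"] res unfolding suc by simp
  qed
  finally show ?case unfolding Suc prod.lessThan_Suc .
qed simp

text \<open>Everything is multiplied by \<open>?R\<close> to avoid infinite products. Going up to
  \<open>5 * m\<close> uses \<open>m\<close> full blocks of residues, and
  \<open>rogers_ramanujan_upto\<close> says that \<open>?R\<close> inverts \<open>rr_sum m 0\<close>
  up to degree \<open>m\<close>.\<close>

lemma gf_plain_mod5_upto:
  "fps_eq_upto m (gf (plain_mod5 0)) (distinct_product m 0 * rr_sum m 0)"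
proof (rule fps_eq_upto_cancel)
  let ?R = "\<Prod>i<m. (1 - fps_X ^ (5 * i + 1)) * (1 - fps_X ^ (5 * i + 4)) :: rat fps"
  show "?R $ 0 \<noteq> 0" by (simp add: fps_nth_0_prod)
  have "gf (plain_mod5 0) * ?R = (\<Prod>k<5 * m. 1 + fps_X ^ Suc k) * gf (plain_mod5 (5 * m))"
    using gf_plain_mod5_product[of "5 * m"] unfolding prod_mod5_residues by (simp only: mult.commute)
  also have "fps_eq_upto m \<dots> ((\<Prod>k<m. 1 + fps_X ^ Suc k) * 1)"
  proof (rule fps_eq_upto_mult)
    show "fps_eq_upto m (\<Prod>k<5 * m. 1 + fps_X ^ Suc k) (\<Prod>k<m. 1 + fps_X ^ Suc k :: rat fps)"
      by (rule fps_eq_upto_prod_truncate) (auto simp: fps_eq_upto_def)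
    show "fps_eq_upto m (gf (plain_mod5 (5 * m))) 1"
      by (rule gf_low[OF plain_mod5_subset]) (simp_all add: plain_mod5_def overparts_def)
  qed
  also have "(\<Prod>k<m. 1 + fps_X ^ Suc k) * 1 = distinct_product m 0 * 1"
    by (simp add: distinct_product_def prod.atLeast1_atMost_eq)
  also have "fps_eq_upto m (distinct_product m 0 * 1) (distinct_product m 0 * (rr_sum m 0 * ?R))"
    using rogers_ramanujan_upto[of m, where 'a = rat]
    by (intro fps_eq_upto_mult) (auto intro: fps_eq_upto_sym simp: rr_sum_def)
  also have "\<dots> = distinct_product m 0 * rr_sum m 0 * ?R"
    by (simp only: mult.assoc)
  finally show "fps_eq_upto m (gf (plain_mod5 0) * ?R) (distinct_product m 0 * rr_sum m 0 * ?R)" .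
qed

theorem theorem1p19:
  fixes n :: nat
  shows "card {p \<in> overpartitions n. gap_condition p \<and> parity_condition p} =
         card {p \<in> overpartitions n.
           \<forall>x\<in>set p. \<not> overlined x \<longrightarrow> psize x mod 5 = 1 \<or> psize x mod 5 = 4}"
proof -
  have "{p \<in> overpartitions n. gap_condition p \<and> parity_condition p}
      = {p \<in> good_overparts 1 True 0. weight p = n}"
    \<comment> \<open>By \<open>good_bound\<close>, the bound 1 on the number of plain parts 1 is
      automatic for the flag \<open>True\<close>.\<close>
    using gap_parity_iff_good good_bound[of _ 0 True]
    by (auto simp: overpartitions_eq good_overparts_def)
  moreover have "{p \<in> overpartitions n. \<forall>x\<in>set p. \<not> overlined x \<longrightarrow> psize x mod 5 = 1 \<or> psize x mod 5 = 4}
      = {p \<in> plain_mod5 0. weight p = n}"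
    by (auto simp: overpartitions_eq plain_mod5_def)
  \<comment> \<open>Truncation at \<open>m = n\<close> suffices to compare the \<open>n\<close>-th
    coefficients.\<close>
  moreover have "gf (good_overparts 1 True 0) $ n = gf (plain_mod5 0) $ n"
    using gf_gap_parity[of n] gf_plain_mod5_upto[of n] by (simp add: fps_eq_upto_def)
  then have "card {p \<in> good_overparts 1 True 0. weight p = n} = card {p \<in> plain_mod5 0. weight p = n}"
    by (simp add: gf_def)
  ultimately show ?thesis by simp
qed

end
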